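(* Fix an equation $(f,q,w)$ as in the context with $\prod_{i=0}^{N-1}(1/f_i)>0$. Let $\gamma\in(-\pi,0)\cup(0,\pi)$ and $K=(k_{ij})\in SL(2,\mathbb R)$ with $k_{11}-f_0k_{12}\neq0$. For $M\in\{K,-K\}$ with entries $m_{ij}$, write $\lambda_j(M)$, $\lambda_j(-M)$, $\lambda_j(e^{i\gamma}M)$ for the eigenvalues with boundary conditions $[M|-I]$, $[-M|-I]$, $[e^{i\gamma}M|-I]$, and $\lambda_j(\mathbf S_K)$ for those with $\mathbf S_K=\begin{pmatrix}1&0&0&0\\0&0&-k_{22}&k_{12}\end{pmatrix}$. Put $m_j=\min\{\lambda_j(M),\lambda_j(-M)\}$ and $M_j=\max\{\lambda_j(M),\lambda_j(-M)\}$. Say that property $P(M)$ holds if for every $0\le j\le N-1$: $\lambda_j(M)<\lambda_j(e^{i\gamma}M)<\lambda_j(-M)$ when $j$ is even, and $\lambda_j(-M)<\lambda_j(e^{i\gamma}M)<\lambda_j(M)$ when $j$ is odd. Then for each $M\in\{K,-K\}$: (i) if $m_{11}-f_0m_{12}>0$ and $m_{12}>0$: $P(M)$ holds, $\lambda_j(\mathbf S_K)\le m_j$ for $0\le j\le N-1$, and $M_j\le\lambda_{j+1}(\mathbf S_K)$ for $0\le j\le N-2$; (ii) if $m_{11}-f_0m_{12}>0$ and $m_{12}<0$: $P(M)$ holds, $M_j\le\lambda_j(\mathbf S_K)\le m_{j+1}$ for $0\le j\le N-2$, and $M_{N-1}\le\lambda_{N-1}(\mathbf S_K)$; (iii) if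 $m_{11}>0$ and $m_{12}=0$: $P(M)$ holds and $M_j\le\lambda_j(\mathbf S_K)\le m_{j+1}$ for $0\le j\le N-2$.
   Context: Let $N\ge2$ be an integer. An equation is given by real sequences $f=\{f_n\}_{n=0}^N$, $q=\{q_n\}_{n=1}^N$, $w=\{w_n\}_{n=1}^N$ with $f_n\neq0$, $w_n>0$; it is $-\nabla(f_n\Delta y_n)+q_ny_n=\lambda w_ny_n$, $1\le n\le N$, for $y=\{y_n\}_{n=0}^{N+1}$, $\Delta y_n=y_{n+1}-y_n$, $\nabla y_n=y_n-y_{n-1}$. A boundary condition $[A\,|\,B]$ (equivalently the $2\times4$ coefficient matrix $(A,B)$ of rank 2) is $A(y_0,f_0\Delta y_0)^T+B(y_N,f_N\Delta y_N)^T=0$; matrices differing by left multiplication by an invertible $2\times2$ complex matrix give the same condition (so $\mathbf S_{-K}=\mathbf S_K$). $SL(2,\mathbb R)$: real $2\times2$ matrices of determinant 1; $I$ the identity. Eigenvalues ($\lambda$ with a nontrivial solution) of these self-adjoint problems are real; multiplicity = dimension of the solution space (equal to the multiplicity as a zero of the characteristic polynomial); counted with multiplicity they are ordered $\lambda_0\le\lambda_1\le\cdots$. *)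

theory Defs
  imports "HOL-Analysis.Analysis" "HOL-Library.Function_Algebras"
begin

text \<open>The difference equation
  -nabla(f_n Delta y_n) + q_n y_n = lambda w_n y_n, for 1 <= n <= N,
  for a complex sequence y_0, ..., y_{N+1} (stored as y :: nat => complex).\<close>
definition sl_eq :: "(nat \<Rightarrow> real) \<Rightarrow> (nat \<Rightarrow> real) \<Rightarrow> (nat \<Rightarrow> real) \<Rightarrow> nat
    \<Rightarrow> complex \<Rightarrow> (nat \<Rightarrow> complex) \<Rightarrow> bool" where
  "sl_eq f q w N lam y \<longleftrightarrow>
     (\<forall>n\<in>{1..N}.
        - (of_real (f n) * (y (n+1) - y n) - of_real (f (n-1)) * (y n - y (n-1)))
        + of_real (q n) * y n = lam * of_real (w n) * y n)"

definition bc_holds :: "complex^2^2 \<Rightarrow> complex^2^2 \<Rightarrow> (nat \<Rightarrow> real) \<Rightarrow> nat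
    \<Rightarrow> (nat \<Rightarrow> complex) \<Rightarrow> bool" where
  "bc_holds A B f N y \<longleftrightarrow>
     A *v vector [y 0, of_real (f 0) * (y 1 - y 0)]
     + B *v vector [y N, of_real (f N) * (y (N+1) - y N)] = 0"

text \<open>Solution space of the boundary value problem at lambda; sequences are
  y_0..y_{N+1}, represented as functions vanishing beyond index N+1.\<close>
definition sol_space :: "(nat \<Rightarrow> real) \<Rightarrow> (nat \<Rightarrow> real) \<Rightarrow> (nat \<Rightarrow> real) \<Rightarrow> nat
    \<Rightarrow> complex^2^2 \<Rightarrow> complex^2^2 \<Rightarrow> complex \<Rightarrow> (nat \<Rightarrow> complex) set" where
  "sol_space f q w N A B lam =
     {y. (\<forall>n>N+1. y n = 0) \<and> sl_eq f q w N lam y \<and> bc_holds A B f N y}"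

definition is_eigenvalue where
  "is_eigenvalue f q w N A B lam \<longleftrightarrow> (\<exists>y\<in>sol_space f q w N A B lam. y \<noteq> 0)"

definition eig_mult :: "(nat \<Rightarrow> real) \<Rightarrow> (nat \<Rightarrow> real) \<Rightarrow> (nat \<Rightarrow> real) \<Rightarrow> nat
    \<Rightarrow> complex^2^2 \<Rightarrow> complex^2^2 \<Rightarrow> complex \<Rightarrow> nat" where
  "eig_mult f q w N A B lam =
     vector_space.dim (\<lambda>(c::complex) (y::nat \<Rightarrow> complex). (\<lambda>n. c * y n)) (sol_space f q w N A B lam)"

definition eig_list where
  "eig_list f q w N A B =
     concat (map (\<lambda>\<mu>::real. replicate (eig_mult f q w N A B (of_real \<mu>)) \<mu>)
       (sorted_list_of_set {\<mu>::real. is_eigenvalue f q w N A B (of_real \<mu>)}))"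

definition eig :: "(nat \<Rightarrow> real) \<Rightarrow> (nat \<Rightarrow> real) \<Rightarrow> (nat \<Rightarrow> real) \<Rightarrow> nat
    \<Rightarrow> complex^2^2 \<Rightarrow> complex^2^2 \<Rightarrow> nat \<Rightarrow> real" where
  "eig f q w N A B j = eig_list f q w N A B ! j"

definition cmat :: "real^2^2 \<Rightarrow> complex^2^2" where
  "cmat M = (\<chi> i j. of_real (M $ i $ j))"

definition eig_per :: "(nat \<Rightarrow> real) \<Rightarrow> (nat \<Rightarrow> real) \<Rightarrow> (nat \<Rightarrow> real) \<Rightarrow> nat
    \<Rightarrow> complex \<Rightarrow> real^2^2 \<Rightarrow> nat \<Rightarrow> real" where
  "eig_per f q w N c M j = eig f q w N (\<chi> i k. c * cmat M $ i $ k) (- mat 1) j"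

definition SK_A :: "complex^2^2" where
  "SK_A = vector [vector [1, 0], vector [0, 0]]"
definition SK_B :: "real^2^2 \<Rightarrow> complex^2^2" where
  "SK_B K = vector [vector [0, 0], vector [- of_real (K$2$2), of_real (K$1$2)]]"

definition prop_P where
  "prop_P f q w N \<gamma> M \<longleftrightarrow>
     (\<forall>j<N. (even j \<longrightarrow> eig_per f q w N 1 M j < eig_per f q w N (cis \<gamma>) M j
                         \<and> eig_per f q w N (cis \<gamma>) M j < eig_per f q w N 1 (-M) j)
          \<and> (odd j \<longrightarrow> eig_per f q w N 1 (-M) j < eig_per f q w N (cis \<gamma>) M j
                         \<and> eig_per f q w N (cis \<gamma>) M j < eig_per f q w N 1 M j))"

end

theory Submission
  imports Defs "HOL-Computational_Algebra.Fundamental_Theorem_Algebra"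
begin

text \<open>
  Let \<open>\<Phi>(\<lambda>)\<close> be the transfer matrix over \<open>0, \<dots>, N\<close>, a matrix polynomial of determinant \<open>1\<close>, and put
  \<open>E = M\<inverse> \<Phi>\<close> and \<open>D = tr E\<close>. For \<open>|c| = 1\<close> the eigenvalues for \<open>[c M | -I]\<close> are the roots of
  \<open>D = 2 Re c\<close>, and an eigenvalue is double iff \<open>E = c I\<close>, which by positivity of \<open>w\<close> happens iff
  \<open>D' = 0\<close>. The eigenvalues for \<open>S\<^sub>K\<close> are the zeros of the entry \<open>e12\<close>; these are real by
  self-adjointness and simple, and \<open>e12' e22 > 0\<close> there. At a zero of \<open>e12\<close> the diagonal entries of
  \<open>E\<close> are reciprocal, so \<open>|D| \<ge> 2\<close>, with the sign of \<open>e12'\<close>, which alternates from zero to zero.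
  Together with the behaviour of \<open>D\<close> at infinity this gives points \<open>t\<^sub>0 < \<dots> < t\<^sub>N\<close> with
  \<open>(-1)\<^sup>k D(t\<^sub>k) \<ge> 2\<close>. As \<open>D\<close> has degree \<open>N\<close>, every level in \<open>[-2, 2]\<close> is taken exactly
  once, with multiplicity, between consecutive \<open>t\<^sub>k\<close>.
\<close>

section \<open>Real polynomials\<close>

lemma prod_linear_factors_dvd:
  fixes p :: "'a::idom poly"
  assumes "finite R" "\<And>x. x \<in> R \<Longrightarrow> poly p x = 0"
  shows "(\<Prod>x\<in>R. [:-x, 1:]) dvd p"
  using assms
proof (induction R)
  case (insert x R)
  then obtain g where g: "p = (\<Prod>x\<in>R. [:-x, 1:]) * g" by (auto elim: dvdE)
  have "poly (\<Prod>x\<in>R. [:-x, 1:]) x \<noteq> 0" using insert.hyps by (auto simp: poly_prod)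
  then have "poly g x = 0" using insert.prems[of x] g by auto
  then obtain h where "g = [:-x, 1:] * h" by (auto simp: poly_eq_0_iff_dvd elim: dvdE)
  then have "p = (\<Prod>x\<in>insert x R. [:-x, 1:]) * h"
    using g insert.hyps by (simp add: mult_ac del: mult_pCons_left mult_pCons_right)
  then show ?case by simp
qed simp

text \<open>All roots are real and simple, so \<open>p\<close> is a constant times the product of
  its linear factors. Its derivative at \<open>\<nu>\<close> is that constant times the product of
  \<open>\<nu> - x\<close> over the other roots, and each root to the right of \<open>\<nu>\<close>
  contributes one sign change.\<close>

lemma sgn_pderiv_root:
  fixes p :: "real poly"
  assumes "p \<noteq> 0" and card: "card {x. poly p x = 0} = degree p" and root: "poly p \<nu> = 0"
  shows "sgn (poly (pderiv p) \<nu>) = sgn (lead_coeff p) * (-1) ^ card {x. poly p x = 0 \<and> \<nu> < x}"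
proof -
  let ?R = "{x. poly p x = 0}"
  have fin: "finite ?R" using assms(1) by (rule poly_roots_finite)
  obtain g where g: "p = (\<Prod>x\<in>?R. [:-x, 1:]) * g"
    using prod_linear_factors_dvd[OF fin, of p] by (auto elim: dvdE)
  have "g \<noteq> 0" using g assms(1) by auto
  have nz: "(\<Prod>x\<in>?R. [:-x, 1:]) \<noteq> 0" using fin by simp
  have "degree (\<Prod>x\<in>?R. [:-x, 1:]) = card ?R"
    using fin by (subst degree_prod_sum_eq) auto
  \<comment> \<open>The linear factors already exhaust the degree of \<open>p\<close>, so the
    cofactor \<open>g\<close> is constant.\<close>
  then have "degree p = card ?R + degree g"
    using degree_mult_eq[OF nz \<open>g \<noteq> 0\<close>] g by metis
  then have "degree g = 0" using card by simp
  then obtain c where c: "g = [:c:]" by (auto elim: degree_eq_zeroE)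
  have "lead_coeff (\<Prod>x\<in>?R. [:-x, 1:]) = 1" by (simp add: lead_coeff_prod)
  then have lc: "lead_coeff p = c"
    using lead_coeff_mult[of "\<Prod>x\<in>?R. [:-x, 1:]" g] g c by (metis lead_coeff_pCons(2) mult_1)
  let ?h = "(\<Prod>x\<in>?R - {\<nu>}. [:-x, 1:]) * g"
  have ph: "p = [:-\<nu>, 1:] * ?h"
    using g prod.remove[OF fin, of \<nu> "\<lambda>x. [:-x, 1:]"] root by (simp add: mult.assoc del: mult_pCons_left)
  have "poly (pderiv p) \<nu> = poly ?h \<nu>"
    by (subst ph, subst pderiv_mult) (simp add: pderiv_pCons)
  also have "\<dots> = (\<Prod>x\<in>?R - {\<nu>}. \<nu> - x) * c" by (simp add: poly_prod c)
  moreover have "sgn (\<Prod>x\<in>A. \<nu> - x) = (\<Prod>x\<in>A. sgn (\<nu> - x))" for A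
    by (induction A rule: infinite_finite_induct) (auto simp: sgn_mult)
  ultimately have "sgn (poly (pderiv p) \<nu>) = sgn c * (\<Prod>x\<in>?R - {\<nu>}. sgn (\<nu> - x))"
    by (simp add: sgn_mult)
  also have "(\<Prod>x\<in>?R - {\<nu>}. sgn (\<nu> - x)) = (\<Prod>x\<in>?R - {\<nu>}. if \<nu> < x then -1 else 1)"
    by (intro prod.cong) (auto simp: sgn_if)
  also have "\<dots> = (-1) ^ card ((?R - {\<nu>}) \<inter> {x. \<nu> < x})"
    using fin by (subst prod.If_cases) auto
  also have "(?R - {\<nu>}) \<inter> {x. \<nu> < x} = {x. poly p x = 0 \<and> \<nu> < x}" by auto
  finally show ?thesis using lc by simp
qed

lemma poly_eventually_ge:
  fixes p :: "real poly"
  assumes "lead_coeff p > 0" "degree p > 0"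
  obtains T where "\<And>x. x \<ge> T \<Longrightarrow> poly p x \<ge> c"
proof -
  have "degree (p + [:-c:]) = degree p" using assms(2) by (intro degree_add_eq_left) simp
  moreover have "coeff (p + [:-c:]) (degree p) = lead_coeff p"
    using assms(2) by (simp add: coeff_pCons split: nat.split)
  ultimately have "lead_coeff (p + [:-c:]) > 0" using assms(1) by simp
  from poly_pinfty_gt_lc[OF this] obtain T where
    "\<And>x. x \<ge> T \<Longrightarrow> poly (p + [:-c:]) x \<ge> lead_coeff (p + [:-c:])" by blast
  then have "poly p x \<ge> c" if "x \<ge> T" for x using that \<open>lead_coeff (p + [:-c:]) > 0\<close> by fastforce
  then show thesis using that by blast
qed

lemma map_poly_of_real_add:
  "map_poly of_real (p + q) = (map_poly of_real p + map_poly of_real q :: 'a::real_algebra_1 poly)"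
  by (rule poly_eqI) (simp add: coeff_map_poly)

lemma map_poly_of_real_mult:
  "map_poly of_real (p * q) = (map_poly of_real p * map_poly of_real q :: 'a::{real_algebra_1,comm_ring_1} poly)"
  by (rule poly_eqI) (simp add: coeff_map_poly coeff_mult)

lemma map_poly_of_real_smult:
  "map_poly of_real (smult a p) = (smult (of_real a) (map_poly of_real p) :: 'a::{real_algebra_1,comm_ring_1} poly)"
  by (rule map_poly_smult) auto

lemma poly_map_poly_of_real:
  "poly (map_poly of_real p) (of_real x) = (of_real (poly p x) :: 'a::{real_algebra_1,comm_ring_1})"
  by (induction p) (auto simp: map_poly_pCons)

text \<open>The fundamental theorem of algebra supplies a complex root, which is real by hypothesis.
  The quotient by its linear factor is again real-rooted, so induction on the degree
  applies.\<close>

lemma size_proots_real_rooted: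
  fixes p :: "real poly"
  assumes "p \<noteq> 0" and "\<And>z::complex. poly (map_poly of_real p) z = 0 \<Longrightarrow> z \<in> \<real>"
  shows "size (proots p) = degree p"
  using assms
proof (induction "degree p" arbitrary: p)
  case 0
  then show ?case using size_proots_le[of p] by simp
next
  case (Suc n)
  have "degree (map_poly complex_of_real p) = Suc n"
    using Suc.hyps(2) by (simp add: degree_map_poly)
  then have "\<not> constant (poly (map_poly complex_of_real p))"
    by (simp add: constant_degree)
  then obtain z where z: "poly (map_poly complex_of_real p) z = 0"
    using fundamental_theorem_of_algebra by blast
  then obtain x where "z = of_real x" using Suc.prems(2) by (auto elim: Reals_cases)
  then have "poly p x = 0" using z by (simp add: poly_map_poly_of_real)
  then obtain r where r: "p = [:-x, 1:] * r" by (auto simp: poly_eq_0_iff_dvd elim: dvdE)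
  with Suc.prems have "r \<noteq> 0" by auto
  then have deg: "degree p = Suc (degree r)" unfolding r by (subst degree_mult_eq) auto
  have "z \<in> \<real>" if "poly (map_poly complex_of_real r) z = 0" for z
    using Suc.prems(2)[of z] that unfolding r map_poly_of_real_mult by simp
  then have "size (proots r) = degree r"
    using Suc.hyps(1)[of r] Suc.hyps(2) deg \<open>r \<noteq> 0\<close> by simp
  then show ?case
    using \<open>r \<noteq> 0\<close> deg by (subst r) (simp add: proots_mult del: mult_pCons_left)
qed

lemma two_le_order_iff:
  fixes p :: "real poly"
  assumes "p \<noteq> 0" "poly p x = 0"
  shows "2 \<le> order x p \<longleftrightarrow> poly (pderiv p) x = 0"
proof -
  have *: "order x p = Suc (order x (pderiv p))"
    using order_pderiv assms by blast
  have "pderiv p \<noteq> 0" using assms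
    by (metis degree_eq_zeroE pderiv_eq_0_iff pCons_0_0 poly_pCons poly_0 mult_zero_right add_0_right)
  then show ?thesis using * order_root[of "pderiv p" x] by linarith
qed

text \<open>Meant for \<open>e12\<close>, whose zeros are real by self-adjointness and simple by a
  Wronskian identity. Every order is 1, so counting roots with multiplicity counts distinct
  ones.\<close>

lemma card_roots_real_rooted:
  fixes p :: "real poly"
  assumes "p \<noteq> 0" and "\<And>z::complex. poly (map_poly of_real p) z = 0 \<Longrightarrow> z \<in> \<real>"
    and simple: "\<And>x. poly p x = 0 \<Longrightarrow> poly (pderiv p) x \<noteq> 0"
  shows "card {x. poly p x = 0} = degree p"
proof -
  have "order x p = 1" if "poly p x = 0" for x
    using two_le_order_iff[OF assms(1) that] simple[OF that] order_root[of p x] that assms(1) by linarith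
  then have "card {x. poly p x = 0} = (\<Sum>x\<in>{x. poly p x = 0}. order x p)"
    by simp
  also have "\<dots> = size (proots p)"
    using assms(1) by (simp add: size_multiset_overloaded_eq)
  also have "\<dots> = degree p" by (rule size_proots_real_rooted[OF assms(1,2)])
  finally show ?thesis .
qed

section \<open>Level crossings of a function with alternating values\<close>

lemma last_crossing:
  fixes g :: "real \<Rightarrow> real"
  assumes g: "continuous_on UNIV g" and "a < s" "g a \<ge> c" "g s < c"
  obtains p where "a \<le> p" "p < s" "g p = c" "\<And>x. p < x \<Longrightarrow> x \<le> s \<Longrightarrow> g x < c"
proof -
  let ?S = "{x \<in> {a..s}. c \<le> g x}"
  have cont: "continuous_on {u..v} g" for u v using g continuous_on_subset by blast
  have "?S = {a..s} \<inter> g -` {c..}" by auto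
  also have "compact \<dots>"
    by (rule compact_Int_closed) (auto intro!: closed_vimage g)
  finally have "compact ?S" .
  moreover have "a \<in> ?S" using assms by auto
  then have "?S \<noteq> {}" by blast
  ultimately obtain p where p: "p \<in> ?S" and max: "\<And>x. x \<in> ?S \<Longrightarrow> x \<le> p"
    using compact_attains_sup[of ?S] by auto
  have less: "g x < c" if "p < x" "x \<le> s" for x
    using max[of x] p that by force
  have "p < s" using p assms(4) by (cases "p = s") auto
  have "g p = c"
  proof (rule ccontr)
    assume "g p \<noteq> c"
    then have "c < g p" using p by auto
    then obtain x where "p \<le> x" "x \<le> s" "g x = c"
      using IVT2'[of g s c p] cont \<open>p < s\<close> assms(4) by auto
    then show False using less[of x] \<open>g p \<noteq> c\<close> by (cases "x = p") auto
  qed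
  then show thesis using that p less \<open>p < s\<close> by auto
qed

lemma first_crossing:
  fixes g :: "real \<Rightarrow> real"
  assumes g: "continuous_on UNIV g" and "s < b" "g b \<le> c" "g s > c"
  obtains p where "s < p" "p \<le> b" "g p = c" "\<And>x. s \<le> x \<Longrightarrow> x < p \<Longrightarrow> g x > c"
proof -
  \<comment> \<open>Reversing both axes turns a first downward crossing into a last one.\<close>
  have "continuous_on UNIV (\<lambda>x. - g (- x))"
    by (intro continuous_on_minus continuous_on_compose2[OF g]) (auto intro: continuous_intros)
  from last_crossing[OF this, of "-b" "-s" "-c"] assms obtain p where
    p: "- b \<le> p" "p < - s" "g (-p) = c" "\<And>x. p < x \<Longrightarrow> x \<le> -s \<Longrightarrow> g (-x) > c" by auto
  show thesis
    using p(1-3) p(4)[of "-x" for x] by (intro that[of "-p"]) auto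
qed

text \<open>The point \<open>s\<close> is chosen first by the intermediate value theorem;
  \<open>p\<close> is then the last crossing of 2 before it and \<open>m\<close> the first crossing
  of -2 after it. The one-sided bounds are kept because they produce a local extremum when crossings
  from neighbouring intervals coincide.\<close>

lemma crossings:
  fixes g :: "real \<Rightarrow> real"
  assumes g: "continuous_on UNIV g" and "a < b" "g a \<ge> 2" "g b \<le> -2" "-2 < c" "c < 2"
  shows "\<exists>p s m. a \<le> p \<and> p < s \<and> s < m \<and> m \<le> b \<and> g p = 2 \<and> g s = c \<and> g m = -2 \<and>
    (\<forall>x. p < x \<and> x \<le> s \<longrightarrow> g x < 2) \<and> (\<forall>x. s \<le> x \<and> x < m \<longrightarrow> g x > -2)"
proof -
  have "continuous_on {a..b} g" using g continuous_on_subset by blast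
  then obtain s where s: "a \<le> s" "s \<le> b" "g s = c"
    using IVT2'[of g b c a] assms by auto
  then have "a < s" "s < b" using assms by (cases "a = s"; cases "s = b"; force)+
  from last_crossing[OF g \<open>a < s\<close>, of 2] assms s
  obtain p where p: "a \<le> p" "p < s" "g p = 2" "\<And>x. p < x \<Longrightarrow> x \<le> s \<Longrightarrow> g x < 2" by auto
  from first_crossing[OF g \<open>s < b\<close>, of "-2"] assms s
  obtain m where m: "s < m" "m \<le> b" "g m = -2" "\<And>x. s \<le> x \<Longrightarrow> x < m \<Longrightarrow> g x > -2" by auto
  from p m s show ?thesis by blast
qed

text \<open>Coinciding picks must lie at the common end point \<open>t (Suc k)\<close>, where the
  bounds from the left and right intervals together make it a local maximum of
  \<open>\<sigma> * D\<close>. The factor \<open>\<sigma>\<close> treats the levels 2 and -2 at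
  once.\<close>

lemma adjacent_roots_at_extremum:
  fixes D :: "real poly" and t r s :: "nat \<Rightarrow> real"
  assumes "\<sigma> \<noteq> 0"
    and k: "t k < s k" "s k < t (Suc k)" "t (Suc k) < s (Suc k)" "r k \<le> t (Suc k)" "t (Suc k) \<le> r (Suc k)"
    and l: "\<And>x. s k \<le> x \<Longrightarrow> x < r k \<Longrightarrow> \<sigma> * poly D x < \<sigma> * c"
    and u: "\<And>x. r (Suc k) < x \<Longrightarrow> x \<le> s (Suc k) \<Longrightarrow> \<sigma> * poly D x < \<sigma> * c"
    and c: "poly D (r k) = c" and eq: "r k = r (Suc k)"
  shows "poly (pderiv D) (r k) = 0"
proof -
  have rk: "r k = t (Suc k)" using k eq by linarith
  \<comment> \<open>The radius reaches only as far as \<open>s k\<close> and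
    \<open>s (Suc k)\<close>, since the bounds hold between these points.\<close>
  define d where "d = min (r k - s k) (s (Suc k) - r k)"
  have "0 < d" using k rk by (auto simp: d_def)
  have "\<sigma> * poly D y \<le> \<sigma> * poly D (r k)" if "\<bar>r k - y\<bar> < d" for y
    using that l[of y] u[of y] eq c unfolding d_def by (cases y "r k" rule: linorder_cases) auto
  moreover have "((\<lambda>x. \<sigma> * poly D x) has_real_derivative \<sigma> * poly (pderiv D) (r k)) (at (r k))"
    by (intro DERIV_cmult poly_DERIV)
  ultimately have "\<sigma> * poly (pderiv D) (r k) = 0"
    using DERIV_local_max \<open>0 < d\<close> by blast
  then show ?thesis using assms(1) by simp
qed

text \<open>The second clause is what survives of the crossings when two neighbouring ones collapse to
  an end point \<open>t (Suc k)\<close>: there \<open>D\<close> touches the level \<open>c\<close> from one side.\<close>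

definition level_roots :: "real poly \<Rightarrow> (nat \<Rightarrow> real) \<Rightarrow> nat \<Rightarrow> real \<Rightarrow> (nat \<Rightarrow> real) \<Rightarrow> bool" where
  "level_roots D t N c r \<longleftrightarrow>
     (\<forall>k<N. t k \<le> r k \<and> r k \<le> t (Suc k) \<and> poly D (r k) = c) \<and>
     (\<forall>k. Suc k < N \<longrightarrow> r k = r (Suc k) \<longrightarrow> poly (pderiv D) (r k) = 0)"

text \<open>On each interval \<open>crossings\<close> is applied to \<open>D\<close> or
  \<open>- D\<close>, according to parity. The three selections are made together, so that their
  order inside the interval is known.\<close>

lemma level_roots_exist:
  fixes D :: "real poly"
  assumes t: "\<And>k. k < N \<Longrightarrow> t k < t (Suc k)"
    and alt: "\<And>k. k \<le> N \<Longrightarrow> (-1) ^ k * poly D (t k) \<ge> 2"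
    and c: "-2 < c" "c < 2"
  obtains p s m where "level_roots D t N 2 p" "level_roots D t N c s" "level_roots D t N (-2) m"
    "\<And>k. k < N \<Longrightarrow> even k \<Longrightarrow> p k < s k \<and> s k < m k"
    "\<And>k. k < N \<Longrightarrow> odd k \<Longrightarrow> m k < s k \<and> s k < p k"
proof -
  let ?D = "poly D"
  \<comment> \<open>The bounds are written as disjunctions so that one predicate serves both orders
    of \<open>p\<close>, \<open>s\<close>, \<open>m\<close>; in each case one half of a disjunction
    is vacuous.\<close>
  define P where "P k p s m \<longleftrightarrow> t k \<le> p \<and> p \<le> t (Suc k) \<and> t k < s \<and> s < t (Suc k) \<and> t k \<le> m \<and> m \<le> t (Suc k) \<and>
    ?D p = 2 \<and> ?D s = c \<and> ?D m = -2 \<and> (even k \<longrightarrow> p < s \<and> s < m) \<and> (odd k \<longrightarrow> m < s \<and> s < p) \<and>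
    (\<forall>x. (p < x \<and> x \<le> s \<or> s \<le> x \<and> x < p) \<longrightarrow> ?D x < 2) \<and>
    (\<forall>x. (m < x \<and> x \<le> s \<or> s \<le> x \<and> x < m) \<longrightarrow> ?D x > -2)" for k p s m
  have "\<exists>p s m. P k p s m" if kN: "k < N" for k
  proof (cases "even k")
    case True
    then have "?D (t k) \<ge> 2" "?D (t (Suc k)) \<le> -2"
      using alt[of k] alt[of "Suc k"] kN by auto
    then have "\<exists>p s m. t k \<le> p \<and> p < s \<and> s < m \<and> m \<le> t (Suc k) \<and> ?D p = 2 \<and> ?D s = c \<and> ?D m = -2 \<and>
      (\<forall>x. p < x \<and> x \<le> s \<longrightarrow> ?D x < 2) \<and> (\<forall>x. s \<le> x \<and> x < m \<longrightarrow> ?D x > -2)"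
      using t[OF kN] c by (intro crossings) (auto intro: continuous_intros)
    then obtain p s m where
      "t k \<le> p \<and> p < s \<and> s < m \<and> m \<le> t (Suc k) \<and> ?D p = 2 \<and> ?D s = c \<and> ?D m = -2 \<and>
      (\<forall>x. p < x \<and> x \<le> s \<longrightarrow> ?D x < 2) \<and> (\<forall>x. s \<le> x \<and> x < m \<longrightarrow> ?D x > -2)" by blast
    note * = this
    have "?D x < 2" if "p < x \<and> x \<le> s \<or> s \<le> x \<and> x < p" for x using * that by (meson less_le_trans not_less_iff_gr_or_eq)
    moreover have "?D x > -2" if "m < x \<and> x \<le> s \<or> s \<le> x \<and> x < m" for x using * that by (meson less_le_trans not_less_iff_gr_or_eq)
    ultimately have "P k p s m" unfolding P_def using True * by simp
    then show ?thesis by blast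
  next
    case False
    then have "?D (t k) \<le> -2" "?D (t (Suc k)) \<ge> 2"
      using alt[of k] alt[of "Suc k"] kN by auto
    \<comment> \<open>Here \<open>D\<close> rises from at most -2 to at least 2; passing to
      \<open>- D\<close> exchanges the roles of \<open>p\<close> and \<open>m\<close>.\<close>
    then have "\<exists>m s p. t k \<le> m \<and> m < s \<and> s < p \<and> p \<le> t (Suc k) \<and> - ?D m = 2 \<and> - ?D s = -c \<and> - ?D p = -2 \<and>
      (\<forall>x. m < x \<and> x \<le> s \<longrightarrow> - ?D x < 2) \<and> (\<forall>x. s \<le> x \<and> x < p \<longrightarrow> - ?D x > -2)"
      using t[OF kN] c by (intro crossings) (auto intro!: continuous_intros)
    then obtain m s p where
      "t k \<le> m \<and> m < s \<and> s < p \<and> p \<le> t (Suc k) \<and> - ?D m = 2 \<and> - ?D s = -c \<and> - ?D p = -2 \<and>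
      (\<forall>x. m < x \<and> x \<le> s \<longrightarrow> - ?D x < 2) \<and> (\<forall>x. s \<le> x \<and> x < p \<longrightarrow> - ?D x > -2)" by blast
    note * = this
    have "- ?D x > -2" if "p < x \<and> x \<le> s \<or> s \<le> x \<and> x < p" for x using * that by (meson less_le_trans not_less_iff_gr_or_eq)
    moreover have "- ?D x < 2" if "m < x \<and> x \<le> s \<or> s \<le> x \<and> x < m" for x using * that by (meson less_le_trans not_less_iff_gr_or_eq)
    ultimately have "P k p s m" unfolding P_def using False * by (simp add: minus_less_iff)
    then show ?thesis by blast
  qed
  then obtain p s m where P: "\<And>k. k < N \<Longrightarrow> P k (p k) (s k) (m k)" by metis
  have p: "t k \<le> p k" "p k \<le> t (Suc k)" "?D (p k) = 2"
    and s: "t k < s k" "s k < t (Suc k)" "?D (s k) = c"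
    and m: "t k \<le> m k" "m k \<le> t (Suc k)" "?D (m k) = -2"
    and lt: "\<And>x. p k < x \<and> x \<le> s k \<or> s k \<le> x \<and> x < p k \<Longrightarrow> ?D x < 2"
    and gt: "\<And>x. m k < x \<and> x \<le> s k \<or> s k \<le> x \<and> x < m k \<Longrightarrow> ?D x > -2" if "k < N" for k
    using P[OF that] unfolding P_def by blast+
  show thesis
  proof (rule that[of p s m])
    have "poly (pderiv D) (p k) = 0" if k: "Suc k < N" and eq: "p k = p (Suc k)" for k
    proof (rule adjacent_roots_at_extremum[where \<sigma> = 1 and c = 2 and t = t and s = s])
      show "1 * ?D x < 1 * 2" if "s k \<le> x" "x < p k" for x using lt[of k x] that k by simp
      show "1 * ?D x < 1 * 2" if "p (Suc k) < x" "x \<le> s (Suc k)" for x using lt[of "Suc k" x] that k by simp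
    qed (use p[of k] p[of "Suc k"] s[of k] s[of "Suc k"] k eq in \<open>simp_all\<close>)
    then show "level_roots D t N 2 p" using p unfolding level_roots_def by blast
    have "poly (pderiv D) (m k) = 0" if k: "Suc k < N" and eq: "m k = m (Suc k)" for k
    proof (rule adjacent_roots_at_extremum[where \<sigma> = "-1" and c = "-2" and t = t and s = s])
      show "-1 * ?D x < -1 * -2" if "s k \<le> x" "x < m k" for x using gt[of k x] that k by simp
      show "-1 * ?D x < -1 * -2" if "m (Suc k) < x" "x \<le> s (Suc k)" for x using gt[of "Suc k" x] that k by simp
    qed (use m[of k] m[of "Suc k"] s[of k] s[of "Suc k"] k eq in \<open>simp_all\<close>)
    then show "level_roots D t N (-2) m" using m unfolding level_roots_def by blast
    \<comment> \<open>Points at the intermediate level lie strictly inside their intervals, so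
      neighbours never coincide and the second clause of \<open>level_roots\<close> holds
      vacuously.\<close>
    have "s k < s (Suc k)" if "Suc k < N" for k
      using s(2)[of k] s(1)[of "Suc k"] that by simp
    then show "level_roots D t N c s" using s unfolding level_roots_def
      by (metis less_imp_le less_irrefl)
  qed (use P[unfolded P_def] in blast)+
qed

lemma level_roots_mono:
  assumes "level_roots D t N c r" "i \<le> j" "j < N"
  shows "r i \<le> r j"
  using assms(2,3)
proof (induction j rule: dec_induct)
  case (step n)
  then have "r i \<le> r n" by simp
  moreover have "r n \<le> t (Suc n)" "t (Suc n) \<le> r (Suc n)"
    using assms(1) step unfolding level_roots_def by auto
  ultimately show ?case by simp
qed simp

text \<open>Picks whose indices differ by at least two are separated by a whole interval of positive
  length. Hence only two neighbouring indices can share a value, and then the second clause of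
  \<open>level_roots\<close> applies.\<close>

lemma level_roots_multiplicity:
  assumes t: "\<And>k. k < N \<Longrightarrow> t k < t (Suc k)" and r: "level_roots D t N c r"
  defines "S \<equiv> \<lambda>\<mu>. {k. k < N \<and> r k = \<mu>}"
  shows "card (S \<mu>) \<le> 2" and "card (S \<mu>) = 2 \<Longrightarrow> poly (pderiv D) \<mu> = 0"
    and "S \<mu> \<noteq> {} \<Longrightarrow> poly D \<mu> = c"
proof -
  show "poly D \<mu> = c" if "S \<mu> \<noteq> {}" using that r unfolding S_def level_roots_def by auto
  have fin: "finite (S \<mu>)" by (simp add: S_def)
  have "card (S \<mu>) \<le> 2 \<and> (card (S \<mu>) = 2 \<longrightarrow> poly (pderiv D) \<mu> = 0)"
  proof (cases "S \<mu> = {}")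
    case False
    define k where "k = Min (S \<mu>)"
    have k: "k \<in> S \<mu>" using False fin by (simp add: k_def)
    have sub: "S \<mu> \<subseteq> {k, Suc k}"
    proof
      fix j assume j: "j \<in> S \<mu>"
      then have "k \<le> j" using fin by (simp add: k_def)
      show "j \<in> {k, Suc k}"
      proof (rule ccontr)
        assume "j \<notin> {k, Suc k}"
        then have kj: "Suc (Suc k) \<le> j" using \<open>k \<le> j\<close> by auto
        have "j < N" using j by (simp add: S_def)
        have "r k \<le> t (Suc k)" "t (Suc k) < t (Suc (Suc k))" "t (Suc (Suc k)) \<le> r (Suc (Suc k))"
          using r t[of "Suc k"] kj \<open>j < N\<close> unfolding level_roots_def by auto
        moreover have "r (Suc (Suc k)) \<le> r j"
          using level_roots_mono[OF r kj \<open>j < N\<close>] .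
        ultimately show False using j k by (simp add: S_def)
      qed
    qed
    then have "card (S \<mu>) \<le> card {k, Suc k}" by (intro card_mono) auto
    then have le: "card (S \<mu>) \<le> 2" by simp
    moreover have "poly (pderiv D) \<mu> = 0" if "card (S \<mu>) = 2"
    proof -
      have "S \<mu> = {k, Suc k}" using card_subset_eq[OF _ sub] that by simp
      then have "Suc k < N" "r k = \<mu>" "r (Suc k) = \<mu>" by (auto simp: S_def)
      then show ?thesis using r unfolding level_roots_def by metis
    qed
    ultimately show ?thesis by blast
  qed simp
  then show "card (S \<mu>) \<le> 2" "card (S \<mu>) = 2 \<Longrightarrow> poly (pderiv D) \<mu> = 0" by auto
qed

text \<open>The selected roots form a sub-multiset, of size \<open>N\<close>, of the roots of \<open>D - c\<close>, which has degree \<open>N\<close>.\<close>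

lemma level_roots_count:
  assumes t: "\<And>k. k < N \<Longrightarrow> t k < t (Suc k)" and r: "level_roots D t N c r"
    and deg: "degree D = N" "N > 0"
  shows "count_list (map r [0..<N]) \<mu> =
    (if poly D \<mu> \<noteq> c then 0 else if poly (pderiv D) \<mu> \<noteq> 0 then 1 else 2)"
proof -
  define p where "p = D + [:-c:]"
  define mult where "mult \<mu> = (if poly D \<mu> \<noteq> c then 0 else if poly (pderiv D) \<mu> \<noteq> 0 then 1 else 2::nat)" for \<mu>
  let ?A = "mset (map r [0..<N])"
  have degp: "degree p = N" unfolding p_def by (subst degree_add_eq_left) (use deg in auto)
  have "p \<noteq> 0"
  proof
    assume "p = 0"
    with degp have "0 = N" by (simp only: degree_0)
    with deg(2) show False by simp
  qed
  have card: "count ?A \<mu> = card {k. k < N \<and> r k = \<mu>}" for \<mu>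
  proof -
    have "count (mset (map r xs)) \<mu> = length (filter (\<lambda>k. r k = \<mu>) xs)" for xs
      by (induction xs) auto
    then have "count ?A \<mu> = length (filter (\<lambda>k. r k = \<mu>) [0..<N])" .
    also have "\<dots> = card (set (filter (\<lambda>k. r k = \<mu>) [0..<N]))"
      by (rule distinct_card[symmetric]) simp
    also have "set (filter (\<lambda>k. r k = \<mu>) [0..<N]) = {k. k < N \<and> r k = \<mu>}" by auto
    finally show ?thesis .
  qed
  have le1: "count ?A \<mu> \<le> mult \<mu>" for \<mu>
  proof -
    have "card {k. k < N \<and> r k = \<mu>} \<noteq> 0 \<Longrightarrow> poly D \<mu> = c"
      by (rule level_roots_multiplicity(3)[OF t r]) (auto simp: card_eq_0_iff)
    then show ?thesis
      using level_roots_multiplicity(1,2)[OF t r, of \<mu>] unfolding mult_def card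
      by (auto simp: le_Suc_eq numeral_2_eq_2)
  qed
  \<comment> \<open>Only an inequality at this stage: higher orders are excluded afterwards by
    comparing sizes.\<close>
  have le2: "mult \<mu> \<le> order \<mu> p" for \<mu>
  proof (cases "poly D \<mu> = c")
    case True
    then have "poly p \<mu> = 0" by (simp add: p_def)
    moreover have "poly (pderiv p) \<mu> = poly (pderiv D) \<mu>"
      by (simp add: p_def pderiv_add pderiv_pCons)
    ultimately show ?thesis
      using two_le_order_iff[OF \<open>p \<noteq> 0\<close>, of \<mu>] order_root[of p \<mu>] \<open>p \<noteq> 0\<close> unfolding mult_def
      by auto
  qed (simp add: mult_def)
  \<comment> \<open>Since \<open>?A\<close> has \<open>N\<close> elements and
    \<open>proots p\<close> at most \<open>N\<close>, containment is equality, and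
    \<open>mult\<close> is squeezed between the two counts.\<close>
  have "?A \<subseteq># proots p"
    using le1 le2 \<open>p \<noteq> 0\<close> by (intro mset_subset_eqI) (auto intro: order_trans)
  moreover have "size (proots p) \<le> size ?A" using size_proots_le[of p] degp by simp
  ultimately have "?A = proots p"
    using mset_subset_size[of ?A "proots p"] by (auto simp: subset_mset.less_le)
  then have "count ?A \<mu> = order \<mu> p" using \<open>p \<noteq> 0\<close> by (metis count_proots)
  then have "count ?A \<mu> = mult \<mu>" using le1[of \<mu>] le2[of \<mu>] by linarith
  then show ?thesis unfolding count_mset mult_def .
qed

section \<open>The transfer matrix\<close>

text \<open>First-order form of the equation, as polynomials in the spectral parameter: the pair is
  the solution and its flux \<open>f n * (y (n+1) - y n)\<close>, started from
  \<open>(a, b)\<close>. The factor \<open>[:q, - w:]\<close> stands for q - lambda w.\<close>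

primrec transfer_poly :: "(nat \<Rightarrow> real) \<Rightarrow> (nat \<Rightarrow> real) \<Rightarrow> (nat \<Rightarrow> real) \<Rightarrow> real \<Rightarrow> real \<Rightarrow> nat
    \<Rightarrow> real poly \<times> real poly" where
  "transfer_poly f q w a b 0 = ([:a:], [:b:])"
| "transfer_poly f q w a b (Suc n) =
     (let (y, z) = transfer_poly f q w a b n; y' = y + smult (1 / f n) z
      in (y', z + [:q (Suc n), - w (Suc n):] * y'))"

locale sl_equation =
  fixes f q w :: "nat \<Rightarrow> real" and N :: nat
  assumes N: "N \<ge> 2" and f: "\<And>n. n \<le> N \<Longrightarrow> f n \<noteq> 0" and w: "\<And>n. n \<in> {1..N} \<Longrightarrow> w n > 0"
    and prod_f: "(\<Prod>i<N. 1 / f i) > 0"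
begin

definition Y where "Y a b n = fst (transfer_poly f q w a b n)"
definition Z where "Z a b n = snd (transfer_poly f q w a b n)"

lemma Y_0 [simp]: "Y a b 0 = [:a:]" and Z_0 [simp]: "Z a b 0 = [:b:]"
  and Y_Suc: "Y a b (Suc n) = Y a b n + smult (1 / f n) (Z a b n)"
  and Z_Suc: "Z a b (Suc n) = Z a b n + [:q (Suc n), - w (Suc n):] * Y a b (Suc n)"
  by (simp_all add: Y_def Z_def Let_def case_prod_beta)

lemma poly_Y_Suc: "poly (Y a b (Suc n)) x = poly (Y a b n) x + poly (Z a b n) x / f n"
  and poly_Z_Suc: "poly (Z a b (Suc n)) x = poly (Z a b n) x + (q (Suc n) - x * w (Suc n)) * poly (Y a b (Suc n)) x"
  by (simp add: Y_Suc) (simp add: Z_Suc algebra_simps)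

lemma poly_pderiv_Y_Suc:
    "poly (pderiv (Y a b (Suc n))) x = poly (pderiv (Y a b n)) x + poly (pderiv (Z a b n)) x / f n"
  and poly_pderiv_Z_Suc:
    "poly (pderiv (Z a b (Suc n))) x = poly (pderiv (Z a b n)) x
       + (q (Suc n) - x * w (Suc n)) * poly (pderiv (Y a b (Suc n))) x - w (Suc n) * poly (Y a b (Suc n)) x"
  by (simp add: Y_Suc pderiv_add pderiv_smult)
    (subst Z_Suc, simp add: pderiv_add pderiv_mult pderiv_smult pderiv_pCons algebra_simps del: mult_pCons_left)

lemma Y_Z_linear:
  "poly (Y a b n) x = a * poly (Y 1 0 n) x + b * poly (Y 0 1 n) x"
  "poly (Z a b n) x = a * poly (Z 1 0 n) x + b * poly (Z 0 1 n) x"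
  by (induction n) (simp_all add: poly_Y_Suc poly_Z_Suc algebra_simps add_divide_distrib)

text \<open>A recursion step is a composition of two shears, one changing only \<open>Y\<close> and
  one changing only \<open>Z\<close>, so the determinant stays 1.\<close>

lemma det_transfer:
  "poly (Y 1 0 n) x * poly (Z 0 1 n) x - poly (Y 0 1 n) x * poly (Z 1 0 n) x = 1"
proof (induction n)
  case (Suc n)
  have "poly (Y 1 0 (Suc n)) x * poly (Z 0 1 (Suc n)) x - poly (Y 0 1 (Suc n)) x * poly (Z 1 0 (Suc n)) x
    = poly (Y 1 0 (Suc n)) x * poly (Z 0 1 n) x - poly (Y 0 1 (Suc n)) x * poly (Z 1 0 n) x"
    unfolding poly_Z_Suc by (simp add: algebra_simps)
  also have "\<dots> = poly (Y 1 0 n) x * poly (Z 0 1 n) x - poly (Y 0 1 n) x * poly (Z 1 0 n) x"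
    unfolding poly_Y_Suc by (simp add: algebra_simps)
  finally show ?case using Suc.IH by simp
qed simp

definition weighted_inner :: "real \<Rightarrow> real \<Rightarrow> real \<Rightarrow> real \<Rightarrow> nat \<Rightarrow> real \<Rightarrow> real" where
  "weighted_inner a b c d n x = (\<Sum>i=1..n. w i * poly (Y a b i) x * poly (Y c d i) x)"

text \<open>The Lagrange identity differentiated in the spectral parameter: the \<open>Y\<close>
  shear preserves the bracket, and the \<open>Z\<close> shear adds one weighted product.\<close>

lemma wronskian:
  "poly (pderiv (Y a b n)) x * poly (Z c d n) x - poly (pderiv (Z a b n)) x * poly (Y c d n) x
     = weighted_inner a b c d n x"
proof (induction n)
  case (Suc n)
  have "poly (pderiv (Y a b (Suc n))) x * poly (Z c d (Suc n)) x
      - poly (pderiv (Z a b (Suc n))) x * poly (Y c d (Suc n)) x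
    = poly (pderiv (Y a b (Suc n))) x * poly (Z c d n) x
      - poly (pderiv (Z a b n)) x * poly (Y c d (Suc n)) x
      + w (Suc n) * poly (Y a b (Suc n)) x * poly (Y c d (Suc n)) x"
    unfolding poly_pderiv_Z_Suc poly_Z_Suc by (simp add: algebra_simps)
  also have "poly (pderiv (Y a b (Suc n))) x * poly (Z c d n) x
      - poly (pderiv (Z a b n)) x * poly (Y c d (Suc n)) x
    = poly (pderiv (Y a b n)) x * poly (Z c d n) x - poly (pderiv (Z a b n)) x * poly (Y c d n) x"
    unfolding poly_pderiv_Y_Suc poly_Y_Suc by (simp add: algebra_simps)
  finally show ?case using Suc.IH by (simp add: weighted_inner_def)
qed (simp add: weighted_inner_def pderiv_pCons)

text \<open>A solution vanishing at 1 and 2, both in range because \<open>N \<ge> 2\<close>, has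
  zero initial data when the recursion is run backwards.\<close>

lemma weighted_inner_pos:
  assumes "a \<noteq> 0 \<or> b \<noteq> 0"
  shows "weighted_inner a b a b N x > 0"
proof -
  have "\<exists>i\<in>{1..N}. poly (Y a b i) x \<noteq> 0"
  proof (rule ccontr)
    assume "\<not> ?thesis"
    then have "poly (Y a b (Suc 0)) x = 0" "poly (Y a b (Suc (Suc 0))) x = 0" using N by auto
    then show False
      using assms f[of 0] f[of 1] N by (auto simp: poly_Y_Suc poly_Z_Suc)
  qed
  then show ?thesis
    unfolding weighted_inner_def
    by (elim bexE, intro sum_pos2) (use w in \<open>auto simp: mult.assoc intro!: mult_nonneg_nonneg less_imp_le[OF w] simp flip: power2_eq_square\<close>)
qed

lemma weighted_inner_expand:
  "weighted_inner s t s t n x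
     = s\<^sup>2 * weighted_inner 1 0 1 0 n x + 2 * s * t * weighted_inner 1 0 0 1 n x
       + t\<^sup>2 * weighted_inner 0 1 0 1 n x"
  unfolding weighted_inner_def sum_distrib_left sum.distrib[symmetric]
  by (intro sum.cong refl) (simp add: Y_Z_linear(1)[of s t] power2_eq_square algebra_simps)

lemma weighted_inner_commute: "weighted_inner a b c d n x = weighted_inner c d a b n x"
  unfolding weighted_inner_def by (simp add: mult_ac)

section \<open>Degrees and leading coefficients\<close>

definition lead :: "nat \<Rightarrow> real" where
  "lead n = (-1) ^ n * (\<Prod>i<n. w (Suc i) / f i)"

lemma lead_Suc: "lead (Suc n) = - w (Suc n) / f n * lead n"
  by (simp add: lead_def)

text \<open>The sign condition on the product of the \<open>1 / f i\<close> enters here and fixes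
  the behaviour of \<open>D\<close> at infinity.\<close>

lemma lead_pos: "(-1) ^ N * lead N > 0"
proof -
  have "(\<Prod>i<N. w (Suc i)) > 0" using w by (intro prod_pos) auto
  moreover have "(\<Prod>i<N. w (Suc i) / f i) = (\<Prod>i<N. w (Suc i)) * (\<Prod>i<N. 1 / f i)"
    by (simp flip: prod.distrib)
  ultimately show ?thesis using prod_f by (simp add: lead_def)
qed

text \<open>The factor \<open>f 0 * a + b\<close> is \<open>f 0\<close> times the value at index 1.
  From there each \<open>Z\<close> step raises the degree by one, so \<open>Y\<close> lags one
  degree behind \<open>Z\<close>.\<close>

lemma Y_Z_leading:
  "degree (Y a b (Suc n)) \<le> n \<and> coeff (Y a b (Suc n)) n = (f 0 * a + b) * lead n / f n \<and>
   degree (Z a b (Suc n)) \<le> Suc n \<and> coeff (Z a b (Suc n)) (Suc n) = (f 0 * a + b) * lead (Suc n)"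
proof (induction n)
  case 0
  show ?case using f[of 0]
    by (simp add: Y_Suc Z_Suc lead_def field_simps)
next
  case (Suc n)
  have Y: "degree (Y a b (Suc (Suc n))) \<le> Suc n"
    unfolding Y_Suc[of a b "Suc n"] using Suc by (intro degree_add_le order_trans[OF degree_smult_le]) auto
  have "coeff (Y a b (Suc n)) (Suc n) = 0" using Suc by (intro coeff_eq_0) auto
  then have Yc: "coeff (Y a b (Suc (Suc n))) (Suc n) = (f 0 * a + b) * lead (Suc n) / f (Suc n)"
    unfolding Y_Suc[of a b "Suc n"] using Suc by simp
  have Z: "degree (Z a b (Suc (Suc n))) \<le> Suc (Suc n)"
    unfolding Z_Suc[of a b "Suc n"]
  proof (rule degree_add_le)
    have "degree ([:q (Suc (Suc n)), - w (Suc (Suc n)):] * Y a b (Suc (Suc n)))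
      \<le> degree [:q (Suc (Suc n)), - w (Suc (Suc n)):] + degree (Y a b (Suc (Suc n)))"
      by (rule degree_mult_le)
    also have "\<dots> \<le> 1 + Suc n" by (intro add_mono Y) auto
    finally show "degree ([:q (Suc (Suc n)), - w (Suc (Suc n)):] * Y a b (Suc (Suc n))) \<le> Suc (Suc n)" by simp
  qed (use Suc in auto)
  have "coeff (Z a b (Suc n)) (Suc (Suc n)) = 0" using Suc by (intro coeff_eq_0) auto
  moreover have "coeff (Y a b (Suc (Suc n))) (Suc (Suc n)) = 0" using Y by (intro coeff_eq_0) auto
  ultimately have Zc: "coeff (Z a b (Suc (Suc n))) (Suc (Suc n)) = (f 0 * a + b) * lead (Suc (Suc n))"
    unfolding Z_Suc[of a b "Suc n"] lead_Suc[of "Suc n"] using Yc by simp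
  show ?case using Y Yc Z Zc by blast
qed

lemma degree_Y: "degree (Y a b N) \<le> N - 1" and coeff_Y: "coeff (Y a b N) (N - 1) = - (f 0 * a + b) * lead N / w N"
  and degree_Z: "degree (Z a b N) \<le> N" and coeff_Z: "coeff (Z a b N) N = (f 0 * a + b) * lead N"
proof -
  obtain n where n: "N = Suc n" using N by (cases N) auto
  have "lead n / f n = - lead N / w N"
    using w[of N] N f[of n] unfolding n lead_Suc by simp
  then have "(f 0 * a + b) * lead n / f n = - (f 0 * a + b) * lead N / w N"
    by (metis (no_types, opaque_lifting) minus_divide_left mult_minus_left mult_minus_right times_divide_eq_right)
  then show "degree (Y a b N) \<le> N - 1" "coeff (Y a b N) (N - 1) = - (f 0 * a + b) * lead N / w N"
    "degree (Z a b N) \<le> N" "coeff (Z a b N) N = (f 0 * a + b) * lead N"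
    using Y_Z_leading[of a b n] unfolding n by auto
qed

text \<open>Green's formula for a solution and its conjugate. Real initial data start the bracket at
  0; the \<open>Y\<close> step adds a real term, and in the \<open>Z\<close> step only the imaginary
  part of \<open>z\<close> contributes.\<close>

lemma complex_lagrange:
  fixes z :: complex and a b :: real
  defines "y \<equiv> \<lambda>n. poly (map_poly of_real (Y a b n)) z"
    and "\<zeta> \<equiv> \<lambda>n. poly (map_poly of_real (Z a b n)) z"
  shows "Im (cnj (y n) * \<zeta> n) = - Im z * (\<Sum>i=1..n. w i * (cmod (y i))\<^sup>2)"
proof (induction n)
  case 0
  then show ?case by (simp add: y_def \<zeta>_def map_poly_pCons)
next
  case (Suc n)
  have y: "y (Suc n) = y n + of_real (1 / f n) * \<zeta> n"
    unfolding y_def \<zeta>_def Y_Suc map_poly_of_real_add map_poly_of_real_smult by simp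
  have z: "\<zeta> (Suc n) = \<zeta> n + (of_real (q (Suc n)) - z * of_real (w (Suc n))) * y (Suc n)"
    unfolding y_def \<zeta>_def Z_Suc map_poly_of_real_add map_poly_of_real_mult
    by (simp add: map_poly_pCons algebra_simps)
  have "Im (cnj (y (Suc n)) * \<zeta> (Suc n)) = Im (cnj (y (Suc n)) * \<zeta> n) - Im z * (w (Suc n) * (cmod (y (Suc n)))\<^sup>2)"
    unfolding z cmod_power2 by (simp add: algebra_simps power2_eq_square)
  also have "Im (cnj (y (Suc n)) * \<zeta> n) = Im (cnj (y n) * \<zeta> n)"
    unfolding y by (simp add: algebra_simps)
  finally show ?case using Suc.IH by (simp add: algebra_simps)
qed

end

section \<open>The matrix \<open>E\<close> and its trace \<open>D\<close>\<close>

locale sl_coupled = sl_equation +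
  fixes M :: "real^2^2"
  assumes det_M: "det M = 1"
begin

abbreviation "m11 \<equiv> M$1$1"
abbreviation "m12 \<equiv> M$1$2"
abbreviation "m21 \<equiv> M$2$1"
abbreviation "m22 \<equiv> M$2$2"

lemma det_M': "m11 * m22 - m12 * m21 = 1"
  using det_M by (simp add: det_2)

text \<open>The entries of \<open>E = M\<inverse> \<Phi>\<close>, where \<open>\<Phi>(\<lambda>)\<close> maps \<open>(y\<^sub>0, f\<^sub>0 \<Delta>y\<^sub>0)\<close> to \<open>(y\<^sub>N, f\<^sub>N \<Delta>y\<^sub>N)\<close>.\<close>

definition "e11 = smult m22 (Y 1 0 N) - smult m12 (Z 1 0 N)"
definition "e12 = smult m22 (Y 0 1 N) - smult m12 (Z 0 1 N)"
definition "e21 = smult m11 (Z 1 0 N) - smult m21 (Y 1 0 N)"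
definition "e22 = smult m11 (Z 0 1 N) - smult m21 (Y 0 1 N)"
definition "D = e11 + e22"

lemmas e_defs = e11_def e12_def e21_def e22_def

lemma transfer_eq:
  "poly (Y 1 0 N) x = m11 * poly e11 x + m12 * poly e21 x"
  "poly (Y 0 1 N) x = m11 * poly e12 x + m12 * poly e22 x"
  "poly (Z 1 0 N) x = m21 * poly e11 x + m22 * poly e21 x"
  "poly (Z 0 1 N) x = m21 * poly e12 x + m22 * poly e22 x"
  unfolding e_defs using det_M' by (simp; algebra)+

lemma det_e: "poly e11 x * poly e22 x - poly e12 x * poly e21 x = 1"
  unfolding e_defs using det_M' det_transfer[of N x] by simp algebra

text \<open>Left multiplication by the constant matrix \<open>M\<inverse>\<close> of determinant 1
  preserves Wronskians, so those of the transfer matrix carry over to \<open>E\<close>.\<close>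

lemma wronskian_e:
  "poly (pderiv e11) x * poly e21 x - poly (pderiv e21) x * poly e11 x = weighted_inner 1 0 1 0 N x"
  "poly (pderiv e11) x * poly e22 x - poly (pderiv e21) x * poly e12 x = weighted_inner 1 0 0 1 N x"
  "poly (pderiv e12) x * poly e21 x - poly (pderiv e22) x * poly e11 x = weighted_inner 1 0 0 1 N x"
  "poly (pderiv e12) x * poly e22 x - poly (pderiv e22) x * poly e12 x = weighted_inner 0 1 0 1 N x"
  unfolding e_defs using det_M' wronskian[of 1 0 N x 1 0] wronskian[of 1 0 N x 0 1]
    wronskian[of 0 1 N x 1 0] wronskian[of 0 1 N x 0 1] weighted_inner_commute[of 0 1 1 0 N x]
  by (simp add: pderiv_diff pderiv_smult; algebra)+

text \<open>Cramer's rule with det E = 1 solves the Wronskian identities for the derivatives of the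
  two diagonal entries.\<close>

lemma pderiv_D:
  "poly (pderiv D) x = poly e21 x * weighted_inner 0 1 0 1 N x
     + (poly e11 x - poly e22 x) * weighted_inner 1 0 0 1 N x - poly e12 x * weighted_inner 1 0 1 0 N x"
proof -
  have "poly (pderiv D) x = poly (pderiv e11) x + poly (pderiv e22) x"
    by (simp add: D_def pderiv_add)
  then show ?thesis using wronskian_e[of x] det_e[of x] by algebra
qed

text \<open>For \<open>D\<^sup>2 \<le> 4\<close> the quadratic form \<open>(e21, e11 - e22, - e12)\<close>, of discriminant \<open>D\<^sup>2 - 4\<close>, is
  semidefinite, and \<open>D'\<close> is its pairing with the positive definite Gram form of the solutions.\<close>

lemma critical_point:
  assumes "(poly D x)\<^sup>2 \<le> 4" "poly (pderiv D) x = 0"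
  shows "(poly D x)\<^sup>2 = 4" "poly e12 x = 0" "poly e21 x = 0" "poly e11 x = poly e22 x"
proof -
  let ?h = "(poly e11 x - poly e22 x) / 2" and ?d = "1 - (poly D x)\<^sup>2 / 4"
  have disc: "- (poly e12 x * poly e21 x) = ?h\<^sup>2 + ?d"
    using det_e[of x] unfolding D_def by (simp add: power2_eq_square field_simps)
  \<comment> \<open>Multiplication by \<open>e21\<close> lets \<open>disc\<close> eliminate the
    product \<open>e12 * e21\<close>; the rest completes to the Gram form at
    \<open>(?h, e21)\<close>. The factor \<open>- e12\<close> does the same below.\<close>
  have "poly e21 x * poly (pderiv D) x
      = weighted_inner ?h (poly e21 x) ?h (poly e21 x) N x + ?d * weighted_inner 1 0 1 0 N x"
    unfolding pderiv_D weighted_inner_expand[of ?h] using disc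
    by (simp add: field_simps power2_eq_square) algebra
  then have a: "weighted_inner ?h (poly e21 x) ?h (poly e21 x) N x + ?d * weighted_inner 1 0 1 0 N x = 0"
    using assms by simp
  have "- (poly e12 x * poly (pderiv D) x)
      = weighted_inner (poly e12 x) (- ?h) (poly e12 x) (- ?h) N x + ?d * weighted_inner 0 1 0 1 N x"
    unfolding pderiv_D weighted_inner_expand[of "poly e12 x"] using disc
    by (simp add: field_simps power2_eq_square) algebra
  then have b: "weighted_inner (poly e12 x) (- ?h) (poly e12 x) (- ?h) N x + ?d * weighted_inner 0 1 0 1 N x = 0"
    using assms by simp
  have "0 \<le> ?d" using assms by simp
  have nonneg: "0 \<le> weighted_inner s t s t N x" for s t
    using weighted_inner_pos[of s t x] by (cases "s = 0 \<and> t = 0") (auto simp: weighted_inner_def Y_Z_linear(1)[of 0 0])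
  \<comment> \<open>Two nonnegative terms with sum 0. Once \<open>?d = 0\<close>, definiteness of
    the Gram form annihilates the vectors as well.\<close>
  have "?d * weighted_inner 1 0 1 0 N x = 0" 
    using a nonneg[of ?h "poly e21 x"] mult_nonneg_nonneg[OF \<open>0 \<le> ?d\<close> nonneg[of 1 0]] by linarith
  then have d0: "?d = 0" using weighted_inner_pos[of 1 0 x] by simp
  then show "(poly D x)\<^sup>2 = 4" by simp
  show "poly e21 x = 0" using a d0 weighted_inner_pos[of ?h "poly e21 x" x] by auto
  show "poly e12 x = 0" using b d0 weighted_inner_pos[of "poly e12 x" "- ?h" x] by auto
  then show "poly e11 x = poly e22 x" using disc d0 by simp
qed

text \<open>At a zero of \<open>e12\<close> the Wronskian of the second column with itself reduces
  to this product. It makes the zeros simple and ties the sign of \<open>e12'\<close> to that of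
  \<open>e22\<close>.\<close>

lemma e12_root_transversal:
  assumes "poly e12 x = 0"
  shows "poly (pderiv e12) x * poly e22 x > 0"
  using wronskian_e(4)[of x] weighted_inner_pos[of 0 1 x] assms by simp

lemma e12_root_D:
  assumes "poly e12 x = 0"
  shows "sgn (poly (pderiv e12) x) * poly D x \<ge> 2"
proof -
  let ?a = "poly e11 x" and ?b = "poly e22 x" and ?s = "sgn (poly (pderiv e12) x)"
  have ab: "?a * ?b = 1" using det_e[of x] assms by simp
  have s: "?s = sgn ?b" using e12_root_transversal[OF assms] by (auto simp: sgn_if zero_less_mult_iff)
  have b: "?b \<noteq> 0" using ab by auto
  have a: "?a = 1 / ?b" using ab b by (simp add: field_simps)
  have "\<bar>?b\<bar> > 0" using b by simp
  moreover have "0 \<le> (\<bar>?b\<bar> - 1)\<^sup>2" by simp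
  ultimately have "2 \<le> \<bar>?b\<bar> + 1 / \<bar>?b\<bar>" by (simp add: field_simps power2_eq_square)
  also have "\<dots> = ?s * poly D x" unfolding s D_def using b by (simp add: a sgn_if abs_if)
  finally show ?thesis .
qed

text \<open>A zero of \<open>e12\<close> is a real linear relation between the value and the flux at
  \<open>N\<close>. It kills the boundary term of \<open>complex_lagrange\<close>, leaving
  \<open>Im z\<close> times a positive sum.\<close>

lemma e12_complex_root_real:
  fixes z :: complex
  assumes "poly (map_poly of_real e12) z = 0"
  shows "z \<in> \<real>"
proof -
  define y where "y n = poly (map_poly complex_of_real (Y 0 1 n)) z" for n
  define \<zeta> where "\<zeta> n = poly (map_poly complex_of_real (Z 0 1 n)) z" for n
  have "e12 = smult m22 (Y 0 1 N) + smult (- m12) (Z 0 1 N)" by (simp add: e12_def)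
  then have eq: "of_real m22 * y N = of_real m12 * \<zeta> N"
    using assms unfolding y_def \<zeta>_def by (simp add: map_poly_of_real_add map_poly_of_real_smult del: smult_minus_left)
  \<comment> \<open>Since det M = 1, \<open>m12\<close> and \<open>m22\<close> do not both vanish,
    so the relation makes one of value and flux a real multiple of the other.\<close>
  have "Im (cnj (y N) * \<zeta> N) = 0"
  proof (cases "m12 = 0")
    case True
    then have "m22 \<noteq> 0" using det_M' by auto
    then show ?thesis using eq True by simp
  next
    case False
    then have "\<zeta> N = of_real (m22 / m12) * y N" using eq by (simp add: field_simps)
    then show ?thesis by (simp add: algebra_simps)
  qed
  then have "Im z * (\<Sum>i=1..N. w i * (cmod (y i))\<^sup>2) = 0"
    using complex_lagrange[of 0 1 N z] unfolding y_def \<zeta>_def by simp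
  moreover have "(\<Sum>i=1..N. w i * (cmod (y i))\<^sup>2) > 0"
  proof (rule sum_pos2)
    have "y 1 = of_real (1 / f 0)" by (simp add: y_def Y_Suc map_poly_pCons)
    then show "0 < w 1 * (cmod (y 1))\<^sup>2" using f[of 0] w[of 1] N by simp
  qed (use N w in \<open>auto intro!: mult_nonneg_nonneg less_imp_le[OF w]\<close>)
  ultimately show ?thesis by (simp add: complex_is_Real_iff)
qed

text \<open>Only the two \<open>Z\<close> terms reach degree \<open>N\<close>; their initial data
  \<open>(1, 0)\<close> and \<open>(0, 1)\<close> give the contributions \<open>- f 0 * m12\<close>
  and \<open>m11\<close>.\<close>

lemma degree_D:
  assumes "m11 - f 0 * m12 \<noteq> 0"
  shows "degree D = N" and "lead_coeff D = (m11 - f 0 * m12) * lead N"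
proof -
  have D: "D = smult m22 (Y 1 0 N) - smult m12 (Z 1 0 N) + (smult m11 (Z 0 1 N) - smult m21 (Y 0 1 N))"
    by (simp add: D_def e_defs)
  have "degree D \<le> N" unfolding D
    by (intro degree_add_le degree_diff_le order_trans[OF degree_smult_le]
        order_trans[OF degree_Y] degree_Z) auto
  moreover have Y: "coeff (Y a b N) N = 0" for a b
    using degree_Y[of a b] N by (intro coeff_eq_0) auto
  have c: "coeff D N = (m11 - f 0 * m12) * lead N"
    unfolding D by (simp add: Y coeff_Z algebra_simps)
  moreover have "lead N \<noteq> 0" using lead_pos by auto
  ultimately show "degree D = N" using assms by (metis le_antisym le_degree mult_eq_0_iff)
  then show "lead_coeff D = (m11 - f 0 * m12) * lead N" using c by simp
qed

text \<open>The \<open>Z\<close> term of degree \<open>N\<close> carries the factor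
  \<open>m12\<close>. When this vanishes the degree drops by one, and the separated problem has only
  \<open>N - 1\<close> eigenvalues.\<close>

lemma degree_e12:
  shows "m12 \<noteq> 0 \<Longrightarrow> degree e12 = N \<and> lead_coeff e12 = - m12 * lead N"
    and "m12 = 0 \<Longrightarrow> degree e12 = N - 1 \<and> lead_coeff e12 = - m22 * lead N / w N"
proof -
  have lead: "lead N \<noteq> 0" using lead_pos by auto
  {
    assume m: "m12 \<noteq> 0"
    have "degree e12 \<le> N" unfolding e12_def
      by (intro degree_diff_le order_trans[OF degree_smult_le] order_trans[OF degree_Y] degree_Z) auto
    moreover have "coeff (Y 0 1 N) N = 0"
      using degree_Y[of 0 1] N by (intro coeff_eq_0) auto
    then have c: "coeff e12 N = - m12 * lead N" unfolding e12_def by (simp add: coeff_Z)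
    ultimately have "degree e12 = N" using m lead by (metis le_antisym le_degree mult_eq_0_iff neg_equal_0_iff_equal)
    then show "degree e12 = N \<and> lead_coeff e12 = - m12 * lead N" using c by simp
  }
  assume m: "m12 = 0"
  then have "m22 \<noteq> 0" using det_M' by auto
  have e: "e12 = smult m22 (Y 0 1 N)" by (simp add: e12_def m)
  have "degree e12 \<le> N - 1" unfolding e by (intro order_trans[OF degree_smult_le] degree_Y)
  moreover have c: "coeff e12 (N - 1) = - m22 * lead N / w N" unfolding e using coeff_Y[of 0 1] by simp
  moreover have "- m22 * lead N / w N \<noteq> 0" using lead \<open>m22 \<noteq> 0\<close> w[of N] N by simp
  ultimately have "degree e12 = N - 1" by (metis le_antisym le_degree)
  then show "degree e12 = N - 1 \<and> lead_coeff e12 = - m22 * lead N / w N" using c by simp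
qed

end

section \<open>Solution spaces\<close>

text \<open>A sorted list is determined by its multiset, so it suffices to compare
  multiplicities.\<close>

lemma eig_list_eqI:
  assumes "sorted xs" and count: "\<And>\<mu>. count_list xs \<mu> = eig_mult f q w N A B (of_real \<mu>)"
    and eig: "\<And>\<mu>::real. is_eigenvalue f q w N A B (of_real \<mu>) \<longleftrightarrow> eig_mult f q w N A B (of_real \<mu>) > 0"
  shows "eig_list f q w N A B = xs"
proof -
  let ?m = "\<lambda>\<mu>::real. eig_mult f q w N A B (of_real \<mu>)"
  have set: "{\<mu>::real. is_eigenvalue f q w N A B (of_real \<mu>)} = set xs"
    unfolding eig count[symmetric] using count_list_0_iff[of xs] by (metis (mono_tags, lifting) Collect_cong Collect_mem_eq neq0_conv)
  have eq: "eig_list f q w N A B = concat (map (\<lambda>\<mu>. replicate (?m \<mu>) \<mu>) (sorted_list_of_set (set xs)))"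
    unfolding eig_list_def set ..
  have sorted: "sorted (concat (map (\<lambda>\<mu>. replicate (m \<mu>) \<mu>) ys))" if "sorted ys" for m :: "real \<Rightarrow> nat" and ys
    using that by (induction ys) (auto simp: sorted_append)
  have cnt: "count (mset (concat (map (\<lambda>\<mu>. replicate (m \<mu>) \<mu>) ys))) x = (if x \<in> set ys then m x else 0)"
    if "distinct ys" for m :: "real \<Rightarrow> nat" and ys x
    using that by (induction ys) auto
  have "mset (eig_list f q w N A B) = mset xs"
  proof (rule multiset_eqI)
    fix x
    show "count (mset (eig_list f q w N A B)) x = count (mset xs) x"
      unfolding eq using count[of x] count_list_0_iff[of xs x]
      by (subst cnt) (auto simp: count_mset)
  qed
  moreover have "sorted (eig_list f q w N A B)"
    unfolding eq by (intro sorted) simp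
  ultimately show ?thesis using \<open>sorted xs\<close>
    by (metis properties_for_sort sorted_sort_id)
qed

interpretation seq: vector_space "\<lambda>(c::complex) (y::nat \<Rightarrow> complex). (\<lambda>n. c * y n)"
  by unfold_locales (auto simp: fun_eq_iff algebra_simps)

context sl_equation
begin

text \<open>Initial data are complex because the factor \<open>cis \<gamma>\<close> makes the
  boundary condition complex. The cut-off after \<open>N + 1\<close> matches the convention of
  \<open>sol_space\<close>.\<close>

definition solc :: "real \<Rightarrow> complex \<Rightarrow> complex \<Rightarrow> nat \<Rightarrow> complex" where
  "solc \<mu> a b n = (if n \<le> N + 1 then a * of_real (poly (Y 1 0 n) \<mu>) + b * of_real (poly (Y 0 1 n) \<mu>) else 0)"

definition fluxc :: "real \<Rightarrow> complex \<Rightarrow> complex \<Rightarrow> nat \<Rightarrow> complex" where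
  "fluxc \<mu> a b n = a * of_real (poly (Z 1 0 n) \<mu>) + b * of_real (poly (Z 0 1 n) \<mu>)"

lemma solc_0: "solc \<mu> a b 0 = a" and fluxc_0: "fluxc \<mu> a b 0 = b"
  by (simp_all add: solc_def fluxc_def)

lemma solc_Suc: "n \<le> N \<Longrightarrow> solc \<mu> a b (Suc n) = solc \<mu> a b n + fluxc \<mu> a b n / of_real (f n)"
  by (simp add: solc_def fluxc_def poly_Y_Suc algebra_simps add_divide_distrib)

lemma flux_eq: "n \<le> N \<Longrightarrow> of_real (f n) * (solc \<mu> a b (Suc n) - solc \<mu> a b n) = fluxc \<mu> a b n"
  using f[of n] by (simp add: solc_Suc)

lemma fluxc_Suc:
  "n < N \<Longrightarrow> fluxc \<mu> a b (Suc n)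
     = fluxc \<mu> a b n + (of_real (q (Suc n)) - of_real \<mu> * of_real (w (Suc n))) * solc \<mu> a b (Suc n)"
  by (simp add: solc_def fluxc_def poly_Z_Suc algebra_simps)

lemma sl_eq_solc: "sl_eq f q w N (of_real \<mu>) (solc \<mu> a b)"
  unfolding sl_eq_def
proof
  fix n assume n: "n \<in> {1..N}"
  then obtain k where k: "n = Suc k" "k < N" by (cases n) auto
  have "of_real (f n) * (solc \<mu> a b (n + 1) - solc \<mu> a b n) = fluxc \<mu> a b (Suc k)"
    using flux_eq[of n \<mu> a b] k by simp
  moreover have "of_real (f (n - 1)) * (solc \<mu> a b n - solc \<mu> a b (n - 1)) = fluxc \<mu> a b k"
    using flux_eq[of k \<mu> a b] k by simp
  ultimately show "- (of_real (f n) * (solc \<mu> a b (n + 1) - solc \<mu> a b n)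
      - of_real (f (n - 1)) * (solc \<mu> a b n - solc \<mu> a b (n - 1))) + of_real (q n) * solc \<mu> a b n
      = of_real \<mu> * of_real (w n) * solc \<mu> a b n"
    using fluxc_Suc[of k \<mu> a b] k by (simp add: algebra_simps)
qed

lemma sl_eq_imp_solc:
  assumes y: "sl_eq f q w N (of_real \<mu>) y" and zero: "\<And>n. n > N + 1 \<Longrightarrow> y n = 0"
  shows "\<exists>a b. y = solc \<mu> a b"
proof -
  define a b where "a = y 0" and "b = of_real (f 0) * (y 1 - y 0)"
  have *: "y n = solc \<mu> a b n \<and> of_real (f n) * (y (Suc n) - y n) = fluxc \<mu> a b n" if "n \<le> N" for n
    using that
  proof (induction n)
    case 0
    then show ?case by (simp add: solc_0 fluxc_0 a_def b_def)
  next
    case (Suc n)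
    then have IH: "y n = solc \<mu> a b n" "of_real (f n) * (y (Suc n) - y n) = fluxc \<mu> a b n" and n: "n < N" by auto
    have "y (Suc n) = y n + fluxc \<mu> a b n / of_real (f n)"
      unfolding IH(2)[symmetric] using f[of n] n by simp
    then have 1: "y (Suc n) = solc \<mu> a b (Suc n)" using solc_Suc[of n] IH(1) n by simp
    have "- (of_real (f (Suc n)) * (y (Suc (Suc n)) - y (Suc n)) - of_real (f n) * (y (Suc n) - y n))
        + of_real (q (Suc n)) * y (Suc n) = of_real \<mu> * of_real (w (Suc n)) * y (Suc n)"
      using y[unfolded sl_eq_def, rule_format, of "Suc n"] n by simp
    then have "of_real (f (Suc n)) * (y (Suc (Suc n)) - y (Suc n))
        = of_real (f n) * (y (Suc n) - y n) + (of_real (q (Suc n)) - of_real \<mu> * of_real (w (Suc n))) * y (Suc n)"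
      by algebra
    then have "of_real (f (Suc n)) * (y (Suc (Suc n)) - y (Suc n)) = fluxc \<mu> a b (Suc n)"
      unfolding IH(2) fluxc_Suc[OF n] by (simp only: 1)
    with 1 show ?case by simp
  qed
  \<comment> \<open>The induction stops at \<open>N\<close>; the value at \<open>N + 1\<close> is
    recovered from the flux at \<open>N\<close>.\<close>
  have "y (Suc N) = y N + fluxc \<mu> a b N / of_real (f N)"
    using *[of N] f[of N] by (simp flip: *[THEN conjunct2])
  then have "y (Suc N) = solc \<mu> a b (Suc N)" using solc_Suc[of N] *[of N] by simp
  then have "y n = solc \<mu> a b n" for n
    using *[of n] zero[of n] by (cases "n \<le> N"; cases "n = Suc N") (auto simp: solc_def)
  then show ?thesis by blast
qed

lemma sol_space_eq: "sol_space f q w N A B (of_real \<mu>) = {solc \<mu> a b |a b. bc_holds A B f N (solc \<mu> a b)}"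
proof -
  have "\<forall>n>N + 1. solc \<mu> a b n = 0" for a b by (simp add: solc_def)
  then show ?thesis unfolding sol_space_def using sl_eq_solc sl_eq_imp_solc by blast
qed

lemma solc_eq_iff: "solc \<mu> a b = solc \<mu> a' b' \<longleftrightarrow> a = a' \<and> b = b'"
proof
  assume *: "solc \<mu> a b = solc \<mu> a' b'"
  have "a = a'" using fun_cong[OF *, of 0] by (simp only: solc_0)
  moreover have "fluxc \<mu> a b 0 = fluxc \<mu> a' b' 0"
    using flux_eq[of 0 \<mu> a b] flux_eq[of 0 \<mu> a' b'] by (simp only: *)
  ultimately show "a = a' \<and> b = b'" by (simp only: fluxc_0)
qed simp

lemma solc_scale: "(\<lambda>n. c * solc \<mu> a b n) = solc \<mu> (c * a) (c * b)"
  and solc_add: "solc \<mu> a b + solc \<mu> a' b' = solc \<mu> (a + a') (b + b')"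
  and solc_zero: "solc \<mu> 0 0 = 0"
  by (auto simp: fun_eq_iff solc_def algebra_simps)

text \<open>Solutions are parametrised by their initial data, so a boundary condition becomes a
  homogeneous 2 by 2 system, and the multiplicity is its nullity.\<close>

lemma eig_mult_linear:
  fixes c11 c12 c21 c22 :: complex
  assumes bc: "\<And>a b. bc_holds A B f N (solc \<mu> a b) \<longleftrightarrow> c11 * a + c12 * b = 0 \<and> c21 * a + c22 * b = 0"
  shows "eig_mult f q w N A B (of_real \<mu>) =
      (if c11 * c22 - c12 * c21 \<noteq> 0 then 0 else if c11 = 0 \<and> c12 = 0 \<and> c21 = 0 \<and> c22 = 0 then 2 else 1)"
    and "is_eigenvalue f q w N A B (of_real \<mu>) \<longleftrightarrow> eig_mult f q w N A B (of_real \<mu>) > 0"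
proof -
  let ?S = "sol_space f q w N A B (of_real \<mu>)"
  let ?m = "eig_mult f q w N A B (of_real \<mu>)"
  have S: "?S = {solc \<mu> a b |a b. c11 * a + c12 * b = 0 \<and> c21 * a + c22 * b = 0}"
    unfolding sol_space_eq bc ..
  have m: "?m = seq.dim ?S" unfolding eig_mult_def ..
  have e: "is_eigenvalue f q w N A B (of_real \<mu>) \<longleftrightarrow> (\<exists>y\<in>?S. y \<noteq> 0)" unfolding is_eigenvalue_def ..
  have dim1: "seq.dim ?S = 1 \<and> (\<exists>y\<in>?S. y \<noteq> 0)"
    if v: "a0 \<noteq> 0 \<or> b0 \<noteq> 0" and iff: "\<And>a b. c11 * a + c12 * b = 0 \<and> c21 * a + c22 * b = 0 \<longleftrightarrow> (\<exists>k. a = k * a0 \<and> b = k * b0)" for a0 b0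
  proof -
    have nz: "solc \<mu> a0 b0 \<noteq> 0" using v solc_eq_iff[of \<mu> a0 b0 0 0] solc_zero by metis
    have S': "?S = range (\<lambda>k. solc \<mu> (k * a0) (k * b0))" unfolding S iff by blast
    have "seq.dim ?S = 1"
    proof (rule seq.dim_unique)
      show "{solc \<mu> a0 b0} \<subseteq> ?S" unfolding S' by (auto intro: range_eqI[of _ _ 1])
      show "?S \<subseteq> seq.span {solc \<mu> a0 b0}" unfolding S' seq.span_singleton solc_scale by blast
    qed (use nz in auto)
    moreover have "solc \<mu> a0 b0 \<in> ?S" unfolding S' by (auto intro: range_eqI[of _ _ 1])
    ultimately show ?thesis using nz by blast
  qed
  consider (zero) "c11 * c22 - c12 * c21 \<noteq> 0" | (two) "c11 = 0 \<and> c12 = 0 \<and> c21 = 0 \<and> c22 = 0"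
    | (one) "c11 * c22 - c12 * c21 = 0" "c11 \<noteq> 0 \<or> c12 \<noteq> 0" | (one') "c11 * c22 - c12 * c21 = 0" "c21 \<noteq> 0 \<or> c22 \<noteq> 0" by blast
  then have "?m = (if c11 * c22 - c12 * c21 \<noteq> 0 then 0 else if c11 = 0 \<and> c12 = 0 \<and> c21 = 0 \<and> c22 = 0 then 2 else 1)
    \<and> (is_eigenvalue f q w N A B (of_real \<mu>) \<longleftrightarrow> ?m > 0)"
  proof cases
    case zero
    have "a = 0 \<and> b = 0" if "c11 * a + c12 * b = 0" "c21 * a + c22 * b = 0" for a b
    proof -
      have "(c11 * c22 - c12 * c21) * a = 0" "(c11 * c22 - c12 * c21) * b = 0" using that by algebra+
      then show ?thesis using zero by simp
    qed
    then have iff: "c11 * a + c12 * b = 0 \<and> c21 * a + c22 * b = 0 \<longleftrightarrow> a = 0 \<and> b = 0" for a b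
      by (metis add_0 mult_zero_right)
    have "?S = {0}" unfolding S iff by (simp add: solc_zero)
    moreover have "seq.dim {0} = 0"
      by (rule seq.dim_unique[of "{}"]) (auto simp: seq.independent_empty)
    ultimately show ?thesis using zero unfolding m e by simp
  next
    case two
    have sub: "{solc \<mu> 1 0, solc \<mu> 0 1} \<subseteq> ?S" unfolding S using two by auto
    have ne: "solc \<mu> 1 0 \<noteq> 0" "solc \<mu> 0 1 \<noteq> 0" using solc_eq_iff[of \<mu> _ _ 0 0] solc_zero[of \<mu>] by (metis zero_neq_one)+
    have "seq.dim ?S = 2"
    proof (rule seq.dim_unique[OF sub])
      show "?S \<subseteq> seq.span {solc \<mu> 1 0, solc \<mu> 0 1}"
      proof
        fix y assume "y \<in> ?S"
        then obtain a b where "y = solc \<mu> a b" unfolding S by blast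
        also have "\<dots> = (\<lambda>n. a * solc \<mu> 1 0 n) + (\<lambda>n. b * solc \<mu> 0 1 n)"
          unfolding solc_scale solc_add by simp
        also have "\<dots> \<in> seq.span {solc \<mu> 1 0, solc \<mu> 0 1}"
          by (intro seq.span_add seq.span_scale seq.span_base) auto
        finally show "y \<in> seq.span {solc \<mu> 1 0, solc \<mu> 0 1}" .
      qed
      have "solc \<mu> 1 0 \<notin> seq.span {solc \<mu> 0 1}"
        unfolding seq.span_singleton solc_scale by (auto simp: solc_eq_iff)
      then show "seq.independent {solc \<mu> 1 0, solc \<mu> 0 1}"
        using ne by (intro seq.independent_insertI) (auto simp: seq.independent_empty)
      show "card {solc \<mu> 1 0, solc \<mu> 0 1} = 2" by (simp add: solc_eq_iff)
    qed
    then show ?thesis using two sub ne unfolding m e by auto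
  next
    case one
    \<comment> \<open>In rank one the kernel is spanned by the vector \<open>(c12, - c11)\<close>
      annihilated by the nonzero first row; the next case uses the second row.\<close>
    have "c11 * a + c12 * b = 0 \<and> c21 * a + c22 * b = 0 \<longleftrightarrow> (\<exists>k. a = k * c12 \<and> b = k * (- c11))" for a b
    proof
      assume eq: "c11 * a + c12 * b = 0 \<and> c21 * a + c22 * b = 0"
      show "\<exists>k. a = k * c12 \<and> b = k * (- c11)"
      proof (cases "c11 = 0")
        case True
        then show ?thesis using eq one by (intro exI[of _ "a / c12"]) auto
      next
        case False
        then show ?thesis using eq by (intro exI[of _ "- b / c11"]) (auto simp: field_simps, algebra)
      qed
    next
      assume "\<exists>k. a = k * c12 \<and> b = k * (- c11)"
      then show "c11 * a + c12 * b = 0 \<and> c21 * a + c22 * b = 0" using one(1)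
        by (elim exE conjE; intro conjI; algebra)
    qed
    then show ?thesis using dim1[of c12 "- c11"] one unfolding m e by auto
  next
    case one'
    have "c11 * a + c12 * b = 0 \<and> c21 * a + c22 * b = 0 \<longleftrightarrow> (\<exists>k. a = k * c22 \<and> b = k * (- c21))" for a b
    proof
      assume eq: "c11 * a + c12 * b = 0 \<and> c21 * a + c22 * b = 0"
      show "\<exists>k. a = k * c22 \<and> b = k * (- c21)"
      proof (cases "c21 = 0")
        case True
        then show ?thesis using eq one' by (intro exI[of _ "a / c22"]) auto
      next
        case False
        then show ?thesis using eq by (intro exI[of _ "- b / c21"]) (auto simp: field_simps, algebra)
      qed
    next
      assume "\<exists>k. a = k * c22 \<and> b = k * (- c21)"
      then show "c11 * a + c12 * b = 0 \<and> c21 * a + c22 * b = 0" using one'(1)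
        by (elim exE conjE; intro conjI; algebra)
    qed
    then show ?thesis using dim1[of c22 "- c21"] one' unfolding m e by auto
  qed
  then show "eig_mult f q w N A B (of_real \<mu>) =
      (if c11 * c22 - c12 * c21 \<noteq> 0 then 0 else if c11 = 0 \<and> c12 = 0 \<and> c21 = 0 \<and> c22 = 0 then 2 else 1)"
    "is_eigenvalue f q w N A B (of_real \<mu>) \<longleftrightarrow> eig_mult f q w N A B (of_real \<mu>) > 0" by auto
qed

lemma solc_N: "solc \<mu> a b N = a * of_real (poly (Y 1 0 N) \<mu>) + b * of_real (poly (Y 0 1 N) \<mu>)"
  by (simp add: solc_def)

lemma bc_holds_solc:
  "bc_holds A B f N (solc \<mu> a b) \<longleftrightarrow>
     A$1$1 * a + A$1$2 * b + (B$1$1 * solc \<mu> a b N + B$1$2 * fluxc \<mu> a b N) = 0 \<and>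
     A$2$1 * a + A$2$2 * b + (B$2$1 * solc \<mu> a b N + B$2$2 * fluxc \<mu> a b N) = 0"
proof -
  have "of_real (f 0) * (solc \<mu> a b 1 - solc \<mu> a b 0) = b"
    using flux_eq[of 0 \<mu> a b] by (simp add: fluxc_0)
  moreover have "of_real (f N) * (solc \<mu> a b (N + 1) - solc \<mu> a b N) = fluxc \<mu> a b N"
    using flux_eq[of N \<mu> a b] by simp
  ultimately show ?thesis
    unfolding bc_holds_def by (simp add: vec_eq_iff forall_2 matrix_vector_mult_def sum_2 solc_0)
qed

end

section \<open>Multiplicities for the coupled and separated conditions\<close>

context sl_coupled
begin

text \<open>The system matrix is \<open>c M - \<Phi> = M (c I - E)\<close>. Its determinant is
  \<open>c * (c + cnj c - D)\<close> because \<open>c * cnj c = 1\<close>, and it vanishes entirely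
  iff E = c I, which on the level set amounts to D' = 0.\<close>

lemma eig_mult_coupled:
  assumes c: "cmod c = 1"
  defines "A \<equiv> (\<chi> i k. c * cmat M $ i $ k)"
  shows "eig_mult f q w N A (- mat 1) (of_real \<mu>) =
      (if poly D \<mu> \<noteq> 2 * Re c then 0 else if poly (pderiv D) \<mu> \<noteq> 0 then 1 else 2)"
    and "is_eigenvalue f q w N A (- mat 1) (of_real \<mu>) \<longleftrightarrow> eig_mult f q w N A (- mat 1) (of_real \<mu>) > 0"
proof -
  let ?p11 = "poly (Y 1 0 N) \<mu>" and ?p12 = "poly (Y 0 1 N) \<mu>"
    and ?p21 = "poly (Z 1 0 N) \<mu>" and ?p22 = "poly (Z 0 1 N) \<mu>"
  define c11 c12 c21 c22 where "c11 = c * of_real m11 - of_real ?p11"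
    and "c12 = c * of_real m12 - of_real ?p12" and "c21 = c * of_real m21 - of_real ?p21"
    and "c22 = c * of_real m22 - of_real ?p22"
  note c_defs = c11_def c12_def c21_def c22_def
  have bc: "bc_holds A (- mat 1) f N (solc \<mu> a b) \<longleftrightarrow> c11 * a + c12 * b = 0 \<and> c21 * a + c22 * b = 0" for a b
    unfolding bc_holds_solc unfolding A_def solc_N fluxc_def cmat_def mat_def c_defs
    by (simp add: algebra_simps)
  note lin = eig_mult_linear[OF bc]
  show "is_eigenvalue f q w N A (- mat 1) (of_real \<mu>) \<longleftrightarrow> eig_mult f q w N A (- mat 1) (of_real \<mu>) > 0"
    by (rule lin(2))
  have "c \<noteq> 0" using c by auto
  have cc: "c * cnj c = 1" using c by (simp add: complex_mult_cnj flip: cmod_power2)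
  have D: "poly D \<mu> = m22 * ?p11 - m12 * ?p21 + (m11 * ?p22 - m21 * ?p12)"
    by (simp add: D_def e_defs)
  have detM: "complex_of_real m11 * of_real m22 - of_real m12 * of_real m21 = 1"
    using det_M' by (metis of_real_1 of_real_diff of_real_mult)
  have detP: "complex_of_real ?p11 * of_real ?p22 - of_real ?p12 * of_real ?p21 = 1"
    using det_transfer[of N \<mu>] by (metis of_real_1 of_real_diff of_real_mult)
  have "c11 * c22 - c12 * c21 = c * c + 1 - c * of_real (poly D \<mu>)"
    unfolding c_defs D using detM detP by (simp only: of_real_diff of_real_add of_real_mult) algebra
  also have "\<dots> = c * (c + cnj c - of_real (poly D \<mu>))" using cc by (simp add: algebra_simps)
  also have "c + cnj c = of_real (2 * Re c)" by (simp add: complex_eq_iff)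
  also have "of_real (2 * Re c) - of_real (poly D \<mu>) = complex_of_real (2 * Re c - poly D \<mu>)"
    by (simp only: of_real_diff)
  finally have det: "c11 * c22 - c12 * c21 = 0 \<longleftrightarrow> poly D \<mu> = 2 * Re c"
    using \<open>c \<noteq> 0\<close> by (simp only: mult_eq_0_iff of_real_eq_0_iff) auto
  have "(c11 = 0 \<and> c12 = 0 \<and> c21 = 0 \<and> c22 = 0) \<longleftrightarrow> poly (pderiv D) \<mu> = 0" if eq: "poly D \<mu> = 2 * Re c"
  proof
    assume "poly (pderiv D) \<mu> = 0"
    moreover have "\<bar>Re c\<bar> \<le> 1" using abs_Re_le_cmod[of c] c by simp
    then have "(poly D \<mu>)\<^sup>2 \<le> 4" unfolding eq using abs_le_square_iff[of "Re c" 1] by (simp add: power_mult_distrib)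
    ultimately have crit: "(poly D \<mu>)\<^sup>2 = 4" "poly e12 \<mu> = 0" "poly e21 \<mu> = 0" "poly e11 \<mu> = poly e22 \<mu>"
      using critical_point[of \<mu>] by auto
    \<comment> \<open>A critical point at this level forces D = 2 or D = -2, so the unimodular
      \<open>c\<close> is real.\<close>
    have "(Re c)\<^sup>2 = 1" using crit(1) unfolding eq by (simp add: power_mult_distrib)
    then have "Im c = 0" using c cmod_power2[of c] by simp
    then have cm: "c * of_real m = of_real (Re c * m)" for m by (simp add: complex_eq_iff)
    have "poly e11 \<mu> = Re c" "poly e22 \<mu> = Re c" using crit(4) eq unfolding D_def by auto
    then have "?p11 = Re c * m11" "?p12 = Re c * m12" "?p21 = Re c * m21" "?p22 = Re c * m22"
      unfolding transfer_eq using crit by auto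
    then show "c11 = 0 \<and> c12 = 0 \<and> c21 = 0 \<and> c22 = 0"
      unfolding c_defs cm by simp
  next
    assume "c11 = 0 \<and> c12 = 0 \<and> c21 = 0 \<and> c22 = 0"
    then have p: "of_real ?p11 = c * of_real m11" "of_real ?p12 = c * of_real m12"
      "of_real ?p21 = c * of_real m21" "of_real ?p22 = c * of_real m22" unfolding c_defs by auto
    have p': "?p11 = Re c * m11" "?p12 = Re c * m12" "?p21 = Re c * m21" "?p22 = Re c * m22"
      using p[THEN arg_cong[where f = Re]] by auto
    have "poly e12 \<mu> = 0" "poly e21 \<mu> = 0" "poly e11 \<mu> = Re c" "poly e22 \<mu> = Re c"
      unfolding e_defs using p' det_M' by (simp; algebra)+
    then show "poly (pderiv D) \<mu> = 0" unfolding pderiv_D by simp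
  qed
  then show "eig_mult f q w N A (- mat 1) (of_real \<mu>) =
      (if poly D \<mu> \<noteq> 2 * Re c then 0 else if poly (pderiv D) \<mu> \<noteq> 0 then 1 else 2)"
    unfolding lin(1) using det by auto
qed

text \<open>The first condition forces the initial value to be 0. The one remaining datum has
  coefficient \<open>- e12\<close> in the second condition, so an eigenvalue is never
  double.\<close>

lemma eig_mult_separated:
  shows "eig_mult f q w N SK_A (SK_B M) (of_real \<mu>) = (if poly e12 \<mu> = 0 then 1 else 0)"
    and "is_eigenvalue f q w N SK_A (SK_B M) (of_real \<mu>) \<longleftrightarrow> eig_mult f q w N SK_A (SK_B M) (of_real \<mu>) > 0"
proof -
  define c21 :: complex where "c21 = of_real (m12 * poly (Z 1 0 N) \<mu> - m22 * poly (Y 1 0 N) \<mu>)"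
  have bc: "bc_holds SK_A (SK_B M) f N (solc \<mu> a b) \<longleftrightarrow>
      1 * a + 0 * b = 0 \<and> c21 * a + of_real (- poly e12 \<mu>) * b = 0" for a b
    unfolding bc_holds_solc unfolding SK_A_def SK_B_def solc_N fluxc_def e12_def c21_def
    by (simp add: algebra_simps)
  note lin = eig_mult_linear[OF bc]
  show "eig_mult f q w N SK_A (SK_B M) (of_real \<mu>) = (if poly e12 \<mu> = 0 then 1 else 0)"
    unfolding lin(1) by simp
  show "is_eigenvalue f q w N SK_A (SK_B M) (of_real \<mu>) \<longleftrightarrow> eig_mult f q w N SK_A (SK_B M) (of_real \<mu>) > 0"
    by (rule lin(2))
qed

end

section \<open>Interlacing\<close>

context sl_coupled
begin

lemma eig_coupled:
  assumes t: "\<And>k. k < N \<Longrightarrow> t k < t (Suc k)" and r: "level_roots D t N (2 * Re c) r"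
    and c: "cmod c = 1" and m: "m11 - f 0 * m12 \<noteq> 0" and "j < N"
  shows "eig_per f q w N c M j = r j"
proof -
  have "eig_list f q w N (\<chi> i k. c * cmat M $ i $ k) (- mat 1) = map r [0..<N]"
  proof (rule eig_list_eqI)
    show "sorted (map r [0..<N])"
      using level_roots_mono[OF r] by (auto simp: sorted_iff_nth_mono)
    show "count_list (map r [0..<N]) \<mu> = eig_mult f q w N (\<chi> i k. c * cmat M $ i $ k) (- mat 1) (of_real \<mu>)" for \<mu>
      unfolding eig_mult_coupled(1)[OF c] using N by (intro level_roots_count[OF t r degree_D(1)[OF m]]) auto
  qed (rule eig_mult_coupled(2)[OF c])
  then show ?thesis unfolding eig_per_def eig_def using \<open>j < N\<close> by simp
qed

text \<open>The condition for \<open>-M\<close> is that for \<open>M\<close> with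
  \<open>c = -1\<close>. All three problems thus become level sets of the same \<open>D\<close>, at
  2, \<open>2 * cos \<gamma>\<close> and -2.\<close>

lemma coupled_interlacing:
  assumes t: "\<And>k. k < N \<Longrightarrow> t k < t (Suc k)"
    and alt: "\<And>k. k \<le> N \<Longrightarrow> (-1) ^ k * poly D (t k) \<ge> 2"
    and m: "m11 - f 0 * m12 \<noteq> 0" and \<gamma>: "\<gamma> \<in> {-pi<..<0} \<union> {0<..<pi}"
  shows "prop_P f q w N \<gamma> M"
    and "j < N \<Longrightarrow> t j \<le> min (eig_per f q w N 1 M j) (eig_per f q w N 1 (-M) j)"
    and "j < N \<Longrightarrow> max (eig_per f q w N 1 M j) (eig_per f q w N 1 (-M) j) \<le> t (Suc j)"
proof -
  have "\<bar>\<gamma>\<bar> < pi" "\<bar>\<gamma>\<bar> > 0" using \<gamma> by auto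
  then have "cos \<bar>\<gamma>\<bar> < cos 0" "cos pi < cos \<bar>\<gamma>\<bar>"
    by (intro cos_monotone_0_pi; simp)+
  then have cos: "-2 < 2 * cos \<gamma>" "2 * cos \<gamma> < 2" by auto
  from level_roots_exist[OF t alt this] obtain p s m where
    p: "level_roots D t N 2 p" and s: "level_roots D t N (2 * cos \<gamma>) s" and m': "level_roots D t N (-2) m"
    and even: "\<And>k. k < N \<Longrightarrow> even k \<Longrightarrow> p k < s k \<and> s k < m k"
    and odd: "\<And>k. k < N \<Longrightarrow> odd k \<Longrightarrow> m k < s k \<and> s k < p k" by metis
  have neg: "eig_per f q w N 1 (-M) = eig_per f q w N (-1) M"
    by (simp add: eig_per_def cmat_def fun_eq_iff)
  have ep: "eig_per f q w N 1 M j = p j" if "j < N" for j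
    using eig_coupled[where c = 1 and r = p and t = t, OF t] p m that by simp
  have em: "eig_per f q w N 1 (-M) j = m j" if "j < N" for j
    unfolding neg using eig_coupled[where c = "-1" and r = m and t = t, OF t] m' m that by simp
  have es: "eig_per f q w N (cis \<gamma>) M j = s j" if "j < N" for j
    using eig_coupled[where c = "cis \<gamma>" and r = s and t = t, OF t] s m that by simp
  show "prop_P f q w N \<gamma> M" unfolding prop_P_def using even odd by (simp add: ep em es)
  show "t j \<le> min (eig_per f q w N 1 M j) (eig_per f q w N 1 (-M) j)"
    "max (eig_per f q w N 1 M j) (eig_per f q w N 1 (-M) j) \<le> t (Suc j)" if "j < N"
    using p m' that unfolding ep[OF that] em[OF that] level_roots_def by auto
qed

text \<open>The zero \<open>\<nu> k\<close> has \<open>degree e12 - Suc k\<close> zeros to its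
  right. This gives the sign of \<open>e12'\<close> there, and \<open>e12_root_D\<close> converts it
  into a bound on \<open>D\<close>.\<close>

lemma separated_eigenvalues:
  obtains \<nu> where "\<And>k. k < degree e12 \<Longrightarrow> eig f q w N SK_A (SK_B M) k = \<nu> k"
    "\<And>i k. i < k \<Longrightarrow> k < degree e12 \<Longrightarrow> \<nu> i < \<nu> k"
    "\<And>k. k < degree e12 \<Longrightarrow> sgn (lead_coeff e12) * (-1) ^ (degree e12 - Suc k) * poly D (\<nu> k) \<ge> 2"
proof -
  let ?R = "{x. poly e12 x = 0}" and ?d = "degree e12"
  define xs where "xs = sorted_list_of_set ?R"
  define \<nu> where "\<nu> k = xs ! k" for k
  have "lead N \<noteq> 0" using lead_pos by auto
  then have "e12 \<noteq> 0"
    using degree_e12 det_M' w[of N] N by (cases "m12 = 0") auto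
  have card: "card ?R = ?d"
    using e12_root_transversal by (intro card_roots_real_rooted \<open>e12 \<noteq> 0\<close> e12_complex_root_real) force+
  have fin: "finite ?R" using \<open>e12 \<noteq> 0\<close> by (rule poly_roots_finite)
  have xs: "set xs = ?R" "distinct xs" "sorted xs" "length xs = ?d"
    using fin card by (auto simp: xs_def)
  have "eig_list f q w N SK_A (SK_B M) = xs"
  proof (rule eig_list_eqI)
    show "count_list xs \<mu> = eig_mult f q w N SK_A (SK_B M) (of_real \<mu>)" for \<mu>
      unfolding eig_mult_separated(1) count_mset[symmetric]
      using xs(1,2) distinct_count_atmost_1[of xs] by auto
  qed (use xs(3) eig_mult_separated(2) in auto)
  then have eig: "eig f q w N SK_A (SK_B M) k = \<nu> k" for k by (simp add: eig_def \<nu>_def)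
  have mono: "\<nu> i < \<nu> k" if "i < k" "k < ?d" for i k
    using that xs unfolding \<nu>_def by (metis sorted_wrt_nth_less strict_sorted_iff)
  have root: "poly e12 (\<nu> k) = 0" if "k < ?d" for k
    using that xs nth_mem unfolding \<nu>_def by force
  have "sgn (lead_coeff e12) * (-1) ^ (?d - Suc k) * poly D (\<nu> k) \<ge> 2" if k: "k < ?d" for k
  proof -
    have "{x. poly e12 x = 0 \<and> \<nu> k < x} = \<nu> ` {Suc k..<?d}"
    proof (intro equalityI subsetI)
      fix x assume x: "x \<in> {x. poly e12 x = 0 \<and> \<nu> k < x}"
      then obtain i where i: "i < ?d" "x = \<nu> i"
        using xs unfolding \<nu>_def by (metis (mono_tags, lifting) in_set_conv_nth mem_Collect_eq)
      then have "k < i" using x mono[of i k] k by (cases i k rule: linorder_cases) auto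
      then show "x \<in> \<nu> ` {Suc k..<?d}" using i by auto
    qed (use mono root in auto)
    moreover have "inj_on \<nu> {Suc k..<?d}"
      by (rule inj_onI) (metis atLeastLessThan_iff less_irrefl linorder_neqE_nat mono)
    ultimately have "card {x. poly e12 x = 0 \<and> \<nu> k < x} = ?d - Suc k"
      by (simp add: card_image)
    then show ?thesis
      using e12_root_D[OF root[OF k]] sgn_pderiv_root[OF \<open>e12 \<noteq> 0\<close> card root[OF k]] by simp
  qed
  then show thesis using that eig mono by blast
qed

lemma D_at_infinity:
  assumes "m11 - f 0 * m12 > 0"
  obtains T where "T > a" "(-1) ^ N * poly D T \<ge> 2"
proof -
  note deg = degree_D[OF less_imp_neq[OF assms, symmetric]]
  have "lead_coeff (smult ((-1) ^ N) D) > 0"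
    unfolding lead_coeff_smult deg(2) using mult_pos_pos[OF assms lead_pos] by (simp only: mult.left_commute)
  moreover have "degree (smult ((-1) ^ N) D) > 0" using deg N by simp
  ultimately obtain T where T: "\<And>x. x \<ge> T \<Longrightarrow> poly (smult ((-1) ^ N) D) x \<ge> 2"
    by (metis poly_eventually_ge)
  show thesis using T[of "max T (a + 1)"] by (intro that[of "max T (a + 1)"]) auto
qed

text \<open>Reflection multiplies the leading coefficient by \<open>(-1) ^ N\<close>, which cancels
  the sign of \<open>lead N\<close>.\<close>

lemma D_at_minus_infinity:
  assumes "m11 - f 0 * m12 > 0"
  obtains T where "T < a" "poly D T \<ge> 2"
proof -
  note deg = degree_D[OF less_imp_neq[OF assms, symmetric]]
  let ?p = "pcompose D [:0, -1:]"
  have "lead_coeff ?p > 0"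
    using mult_pos_pos[OF assms lead_pos] deg by (subst lead_coeff_comp) (simp_all only: deg, simp_all add: mult_ac)
  moreover have "degree ?p > 0" using deg N by (simp add: degree_pcompose)
  ultimately obtain T where T: "\<And>x. x \<ge> T \<Longrightarrow> poly ?p x \<ge> 2"
    by (metis poly_eventually_ge)
  show thesis using T[of "max T (1 - a)"] by (intro that[of "- max T (1 - a)"]) (auto simp: poly_pcompose)
qed

lemma sgn_lead: "sgn (lead N) = (-1) ^ N"
  using lead_pos by (cases "even N") (auto simp: sgn_if)

text \<open>Here \<open>D \<ge> 2\<close> already at the first zero of \<open>e12\<close>, so the
  \<open>N\<close> zeros serve as \<open>t 0\<close> to \<open>t (N - 1)\<close> and one point far
  to the right is appended.\<close>

lemma interlacing_pos:
  assumes m: "m11 - f 0 * m12 > 0" and "m12 > 0" and \<gamma>: "\<gamma> \<in> {-pi<..<0} \<union> {0<..<pi}"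
  defines "lM \<equiv> eig_per f q w N 1 M" and "lmM \<equiv> eig_per f q w N 1 (-M)"
    and "lS \<equiv> eig f q w N SK_A (SK_B M)"
  shows "prop_P f q w N \<gamma> M \<and> (\<forall>j<N. lS j \<le> min (lM j) (lmM j)) \<and>
    (\<forall>j. Suc j < N \<longrightarrow> max (lM j) (lmM j) \<le> lS (Suc j))"
proof -
  note e12 = degree_e12(1)[OF less_imp_neq[OF \<open>m12 > 0\<close>, symmetric]]
  have "sgn (lead_coeff e12) = - ((-1) ^ N)"
    unfolding e12[THEN conjunct2] sgn_mult sgn_lead using \<open>m12 > 0\<close> by simp
  then have deg: "degree e12 = N" "sgn (coeff e12 N) = - ((-1) ^ N)"
    by (simp_all only: e12[THEN conjunct1])
  from separated_eigenvalues obtain \<nu> where \<nu>: "\<And>k. k < N \<Longrightarrow> lS k = \<nu> k"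
    "\<And>i k. i < k \<Longrightarrow> k < N \<Longrightarrow> \<nu> i < \<nu> k"
    "\<And>k. k < N \<Longrightarrow> - ((-1) ^ N) * (-1) ^ (N - Suc k) * poly D (\<nu> k) \<ge> 2"
    unfolding deg lS_def by blast
  from D_at_infinity[OF m] obtain T where T: "T > \<nu> (N - 1)" "(-1) ^ N * poly D T \<ge> 2" by blast
  define t where "t k = (if k < N then \<nu> k else T)" for k
  have "- ((-1) ^ N) * (-1) ^ (N - Suc k) = ((-1) ^ k :: real)" if "k < N" for k
    using that by (simp add: minus_one_power_iff)
  then have alt: "(-1) ^ k * poly D (t k) \<ge> 2" if "k \<le> N" for k
    using that \<nu>(3)[of k] T by (cases "k = N") (auto simp: t_def)
  have t: "t k < t (Suc k)" if "k < N" for k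
    using that \<nu>(2)[of k "Suc k"] T by (cases "Suc k = N") (auto simp: t_def)
  note int = coupled_interlacing[OF t alt less_imp_neq[OF m, symmetric] \<gamma>, folded lM_def lmM_def]
  have "lS j \<le> min (lM j) (lmM j)" if "j < N" for j
    using int(2)[of j] \<nu>(1)[of j] that by (simp add: t_def)
  moreover have "max (lM j) (lmM j) \<le> lS (Suc j)" if "Suc j < N" for j
    using int(3)[of j] \<nu>(1)[OF that] that by (simp add: t_def)
  ultimately show ?thesis using int(1) by blast
qed

text \<open>Here \<open>D \<le> -2\<close> at the first zero of \<open>e12\<close>, so a point far
  to the left is prepended and the zeros are shifted: \<open>\<nu> k\<close> is
  \<open>t (Suc k)\<close>.\<close>

lemma interlacing_neg:
  assumes m: "m11 - f 0 * m12 > 0" and "m12 < 0" and \<gamma>: "\<gamma> \<in> {-pi<..<0} \<union> {0<..<pi}"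
  defines "lM \<equiv> eig_per f q w N 1 M" and "lmM \<equiv> eig_per f q w N 1 (-M)"
    and "lS \<equiv> eig f q w N SK_A (SK_B M)"
  shows "prop_P f q w N \<gamma> M \<and> (\<forall>j<N. max (lM j) (lmM j) \<le> lS j) \<and>
    (\<forall>j. Suc j < N \<longrightarrow> lS j \<le> min (lM (Suc j)) (lmM (Suc j)))"
proof -
  note e12 = degree_e12(1)[OF less_imp_neq[OF \<open>m12 < 0\<close>]]
  have "sgn (lead_coeff e12) = (-1) ^ N"
    unfolding e12[THEN conjunct2] sgn_mult sgn_lead using \<open>m12 < 0\<close> by simp
  then have deg: "degree e12 = N" "sgn (coeff e12 N) = (-1) ^ N"
    by (simp_all only: e12[THEN conjunct1])
  from separated_eigenvalues obtain \<nu> where \<nu>: "\<And>k. k < N \<Longrightarrow> lS k = \<nu> k"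
    "\<And>i k. i < k \<Longrightarrow> k < N \<Longrightarrow> \<nu> i < \<nu> k"
    "\<And>k. k < N \<Longrightarrow> (-1) ^ N * (-1) ^ (N - Suc k) * poly D (\<nu> k) \<ge> 2"
    unfolding deg lS_def by blast
  from D_at_minus_infinity[OF m] obtain T where T: "T < \<nu> 0" "poly D T \<ge> 2" by blast
  define t where "t k = (case k of 0 \<Rightarrow> T | Suc i \<Rightarrow> \<nu> i)" for k
  have "(-1) ^ N * (-1) ^ (N - Suc k) = ((-1) ^ Suc k :: real)" if "k < N" for k
    using that by (simp add: minus_one_power_iff)
  then have alt: "(-1) ^ k * poly D (t k) \<ge> 2" if "k \<le> N" for k
    using that \<nu>(3)[of "k - 1"] T by (cases k) (auto simp: t_def)
  have t: "t k < t (Suc k)" if "k < N" for k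
    using that \<nu>(2)[of "k - 1" k] T by (cases k) (auto simp: t_def)
  note int = coupled_interlacing[OF t alt less_imp_neq[OF m, symmetric] \<gamma>, folded lM_def lmM_def]
  show ?thesis using int(1,3) int(2)[of "Suc j" for j] \<nu>(1) by (auto simp: t_def)
qed

text \<open>With only \<open>N - 1\<close> zeros, and \<open>D \<le> -2\<close> at the first, a
  point is added at each end.\<close>

lemma interlacing_zero:
  assumes "m11 > 0" and m12: "m12 = 0" and \<gamma>: "\<gamma> \<in> {-pi<..<0} \<union> {0<..<pi}"
  defines "lM \<equiv> eig_per f q w N 1 M" and "lmM \<equiv> eig_per f q w N 1 (-M)"
    and "lS \<equiv> eig f q w N SK_A (SK_B M)"
  shows "prop_P f q w N \<gamma> M \<and> (\<forall>j<N - 1. max (lM j) (lmM j) \<le> lS j \<and> lS j \<le> min (lM (Suc j)) (lmM (Suc j)))"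
proof -
  have m: "m11 - f 0 * m12 > 0" using assms by simp
  have "m22 > 0" using det_M' m12 \<open>m11 > 0\<close> by (metis diff_zero mult_zero_left zero_less_mult_pos zero_less_one)
  note e12 = degree_e12(2)[OF m12]
  have "sgn (lead_coeff e12) = - ((-1) ^ N)"
    unfolding e12[THEN conjunct2] sgn_mult sgn_divide sgn_lead using \<open>m22 > 0\<close> w[of N] N by simp
  then have deg: "degree e12 = N - 1" "sgn (coeff e12 (N - 1)) = - ((-1) ^ N)"
    by (simp_all only: e12[THEN conjunct1])
  from separated_eigenvalues obtain \<nu> where \<nu>: "\<And>k. k < N - 1 \<Longrightarrow> lS k = \<nu> k"
    "\<And>i k. i < k \<Longrightarrow> k < N - 1 \<Longrightarrow> \<nu> i < \<nu> k"
    "\<And>k. k < N - 1 \<Longrightarrow> - ((-1) ^ N) * (-1) ^ (N - 1 - Suc k) * poly D (\<nu> k) \<ge> 2"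
    unfolding deg lS_def by blast
  from D_at_minus_infinity[OF m] obtain S where S: "S < \<nu> 0" "poly D S \<ge> 2" by blast
  from D_at_infinity[OF m] obtain T where T: "T > \<nu> (N - 2)" "(-1) ^ N * poly D T \<ge> 2" by blast
  define t where "t k = (case k of 0 \<Rightarrow> S | Suc i \<Rightarrow> if k < N then \<nu> i else T)" for k
  have "- ((-1) ^ N) * (-1) ^ (N - 1 - Suc k) = ((-1) ^ Suc k :: real)" if "k < N - 1" for k
    using that by (auto simp: minus_one_power_iff)
  then have alt: "(-1) ^ k * poly D (t k) \<ge> 2" if "k \<le> N" for k
    using that \<nu>(3)[of "k - 1"] S T by (cases k; cases "k = N") (auto simp: t_def)
  have t: "t k < t (Suc k)" if "k < N" for k
    using that \<nu>(2)[of "k - 1" k] S T N by (cases k; cases "Suc k = N") (auto simp: t_def numeral_2_eq_2)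
  note int = coupled_interlacing[OF t alt less_imp_neq[OF m, symmetric] \<gamma>, folded lM_def lmM_def]
  have "max (lM j) (lmM j) \<le> lS j \<and> lS j \<le> min (lM (Suc j)) (lmM (Suc j))" if "j < N - 1" for j
  proof -
    have "Suc j < N" using that by simp
    then have "t (Suc j) = lS j" using that \<nu>(1)[of j] by (simp add: t_def)
    then show ?thesis using int(3)[of j] int(2)[of "Suc j"] that by simp
  qed
  then show ?thesis using int(1) by blast
qed

end

text \<open>Negation multiplies the second boundary row by -1. Hence the separated problem of
  \<open>K\<close> serves both choices of \<open>M\<close>.\<close>

lemma eig_SK_B_uminus: "eig f q w N SK_A (SK_B (-K)) = eig f q w N SK_A (SK_B K)"
proof -
  have "bc_holds SK_A (SK_B (-K)) f N y \<longleftrightarrow> bc_holds SK_A (SK_B K) f N y" for y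
    unfolding bc_holds_def SK_A_def SK_B_def
    by (simp add: vec_eq_iff forall_2 matrix_vector_mult_def sum_2) (metis add.commute add_eq_0_iff2 minus_minus mult_minus_left)
  then have "sol_space f q w N SK_A (SK_B (-K)) = sol_space f q w N SK_A (SK_B K)"
    unfolding sol_space_def by (simp add: fun_eq_iff)
  then show ?thesis
    unfolding eig_def eig_list_def eig_mult_def is_eigenvalue_def by (simp add: fun_eq_iff)
qed

theorem theorem3p8:
  fixes N :: nat and f q w :: "nat \<Rightarrow> real" and K :: "real^2^2" and \<gamma> :: real
  assumes "N \<ge> 2"
    and "\<forall>n\<le>N. f n \<noteq> 0"
    and "\<forall>n\<in>{1..N}. w n > 0"
    and "(\<Prod>i<N. 1 / f i) > 0"
    and "\<gamma> \<in> {-pi<..<0} \<union> {0<..<pi}"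
    and "det K = 1"
    and "K$1$1 - f 0 * K$1$2 \<noteq> 0"
  shows "\<forall>M \<in> {K, -K}.
    (let lM = eig_per f q w N 1 M; lmM = eig_per f q w N 1 (-M);
         lS = eig f q w N SK_A (SK_B K);
         mn = (\<lambda>j. min (lM j) (lmM j)); mx = (\<lambda>j. max (lM j) (lmM j))
     in
      (M$1$1 - f 0 * M$1$2 > 0 \<and> M$1$2 > 0 \<longrightarrow>
         prop_P f q w N \<gamma> M
         \<and> (\<forall>j\<le>N-1. lS j \<le> mn j)
         \<and> (\<forall>j\<le>N-2. mx j \<le> lS (j+1)))
    \<and> (M$1$1 - f 0 * M$1$2 > 0 \<and> M$1$2 < 0 \<longrightarrow>
         prop_P f q w N \<gamma> M
         \<and> (\<forall>j\<le>N-2. mx j \<le> lS j \<and> lS j \<le> mn (j+1))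
         \<and> mx (N-1) \<le> lS (N-1))
    \<and> (M$1$1 > 0 \<and> M$1$2 = 0 \<longrightarrow>
         prop_P f q w N \<gamma> M
         \<and> (\<forall>j\<le>N-2. mx j \<le> lS j \<and> lS j \<le> mn (j+1))))"
    (is "\<forall>M \<in> _. ?P M")
proof
  fix M assume M: "M \<in> {K, -K}"
  \<comment> \<open>In dimension 2 negation preserves the determinant, so \<open>-K\<close>
    qualifies as well.\<close>
  interpret sl_coupled f q w N M
    using assms M by unfold_locales (auto simp: det_2)
  have lS: "eig f q w N SK_A (SK_B K) = eig f q w N SK_A (SK_B M)"
    using M eig_SK_B_uminus by auto
  \<comment> \<open>Since \<open>N \<ge> 2\<close>, the truncated differences in the index ranges
    are true differences.\<close>
  have bounds: "j \<le> N - 1 \<longleftrightarrow> j < N" "j \<le> N - 2 \<longleftrightarrow> Suc j < N" "j < N - 1 \<longleftrightarrow> Suc j < N" for j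
    using N by auto
  let ?lM = "eig_per f q w N 1 M" and ?lmM = "eig_per f q w N 1 (-M)" and ?lS = "eig f q w N SK_A (SK_B M)"
  have 1: "prop_P f q w N \<gamma> M \<and> (\<forall>j\<le>N - 1. ?lS j \<le> min (?lM j) (?lmM j))
      \<and> (\<forall>j\<le>N - 2. max (?lM j) (?lmM j) \<le> ?lS (j + 1))"
    if "m11 - f 0 * m12 > 0 \<and> m12 > 0"
    using interlacing_pos[OF _ _ assms(5)] that unfolding bounds Suc_eq_plus1[symmetric] by blast
  have 2: "prop_P f q w N \<gamma> M \<and> (\<forall>j\<le>N - 2. max (?lM j) (?lmM j) \<le> ?lS j \<and> ?lS j \<le> min (?lM (j + 1)) (?lmM (j + 1)))
      \<and> max (?lM (N - 1)) (?lmM (N - 1)) \<le> ?lS (N - 1)"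
    if "m11 - f 0 * m12 > 0 \<and> m12 < 0"
  proof -
    note neg = interlacing_neg[OF that[THEN conjunct1] that[THEN conjunct2] assms(5)]
    have "max (?lM j) (?lmM j) \<le> ?lS j" if "Suc j < N" for j
      using neg Suc_lessD[OF that] by blast
    moreover have "N - 1 < N" using N by simp
    ultimately show ?thesis
      using neg unfolding bounds Suc_eq_plus1[symmetric] by blast
  qed
  have 3: "prop_P f q w N \<gamma> M \<and> (\<forall>j\<le>N - 2. max (?lM j) (?lmM j) \<le> ?lS j \<and> ?lS j \<le> min (?lM (j + 1)) (?lmM (j + 1)))"
    if "m11 > 0 \<and> m12 = 0"
    using interlacing_zero[OF _ _ assms(5)] that unfolding bounds Suc_eq_plus1[symmetric] by blast
  show "?P M" unfolding Let_def lS using 1 2 3 by blast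
qed

end
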